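(* Let $k\geq 2$ be an integer, and let $G$ be a connected graph with minimum degree $\delta\geq 2k$ and order $n\geq 2\delta+3$. If $\rho(G)\geq \rho(B_{n,\delta+1}^{k-1})$, then $\tau(G)\geq k$ unless $G\cong B_{n,\delta+1}^{k-1}$.
   Context: All graphs are finite, undirected and simple. The order of a graph is its number of vertices. The spectral radius $\rho(G)$ is the largest eigenvalue of the adjacency matrix of $G$. The spanning tree packing number $\tau(G)$ is the maximum number of pairwise edge-disjoint spanning trees contained in $G$. $K_m$ denotes the complete graph on $m$ vertices. $B_{n,\delta+1}^{i}$ denotes the graph obtained from the disjoint union $K_{\delta+1}\cup K_{n-\delta-1}$ by adding $i$ edges joining a single vertex of $K_{\delta+1}$ to $i$ distinct vertices of $K_{n-\delta-1}$ (unique up to isomorphism). *)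

theory Defs
  imports
    "Graph_Theory.Digraph_Isomorphism"
    "Jordan_Normal_Form.Spectral_Radius"
begin

text \<open>
  A finite simple undirected graph is a \<^locale>\<open>pair_graph\<close>: a finite, loop-free, symmetric relation
  on a finite vertex set, each edge being represented by its two opposite arcs.
\<close>

text \<open>In a \<^locale>\<open>pair_graph\<close>, in-degree, out-degree and undirected degree coincide.\<close>

definition min_degree :: "'a pair_pre_digraph \<Rightarrow> nat" where
  "min_degree G = Min (out_degree (with_proj G) ` pverts G)"

definition adjacency_matrix :: "'a list \<Rightarrow> 'a pair_pre_digraph \<Rightarrow> real mat" where
  "adjacency_matrix vs G =
     mat (length vs) (length vs) (\<lambda>(i, j). of_bool ((vs ! i, vs ! j) \<in> parcs G))"

definition vertex_list :: "'a pair_pre_digraph \<Rightarrow> 'a list" where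
  "vertex_list G = (SOME vs. distinct vs \<and> set vs = pverts G)"

text \<open>
  The adjacency matrix is real symmetric, so its eigenvalues are its real eigenvalues.  The order in
  which the vertices are listed does not matter, see \<open>graph_rho_eq\<close> below.
  (\<^const>\<open>spectral_radius\<close> is instead the largest modulus of an eigenvalue of a complex matrix.)
\<close>

definition graph_rho :: "'a pair_pre_digraph \<Rightarrow> real" where
  "graph_rho G = Max (spectrum (adjacency_matrix (vertex_list G) G))"

text \<open>
  \<^const>\<open>forest\<close> and \<^const>\<open>tree\<close> are about directed cycles, and for them the two arcs of one
  undirected edge form a cycle.  In a \<^locale>\<open>pair_graph\<close> the directed cycles with at least three
  arcs are precisely the traversals of the undirected cycles.
\<close>

definition undirected_tree :: "'a pair_pre_digraph \<Rightarrow> bool" where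
  "undirected_tree T \<longleftrightarrow> pair_graph T \<and> Digraph_Component.connected (with_proj T) \<and>
     \<not> (\<exists>p. pre_digraph.cycle (with_proj T) p \<and> length p \<ge> 3)"

definition undirected_spanning_tree :: "'a pair_pre_digraph \<Rightarrow> 'a pair_pre_digraph \<Rightarrow> bool" where
  "undirected_spanning_tree T G \<longleftrightarrow> undirected_tree T \<and> spanning (with_proj T) (with_proj G)"

definition spanning_tree_packing :: "'a pair_pre_digraph set \<Rightarrow> 'a pair_pre_digraph \<Rightarrow> bool" where
  "spanning_tree_packing \<T> G \<longleftrightarrow> (\<forall>T\<in>\<T>. undirected_spanning_tree T G) \<and>
     pairwise (\<lambda>S T. parcs S \<inter> parcs T = {}) \<T>"

definition spanning_tree_packing_number :: "'a pair_pre_digraph \<Rightarrow> nat" where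
  "spanning_tree_packing_number G = Max {card \<T> | \<T>. spanning_tree_packing \<T> G}"

text \<open>
  \<open>B_graph n s i\<close> is the graph $B_{n,s}^{i}$: a complete graph on \<open>{..<s}\<close>, a complete graph on
  \<open>{s..<n}\<close>, and the edges joining vertex 0 to the \<open>i\<close> vertices \<open>s, \<dots>, s + i - 1\<close>.
  It is meaningful for \<open>0 < s\<close> and \<open>s + i \<le> n\<close>.
\<close>

definition B_graph :: "nat \<Rightarrow> nat \<Rightarrow> nat \<Rightarrow> nat pair_pre_digraph" where
  "B_graph n s i = \<lparr> pverts = {..<n},
     parcs = {(u, v). u \<in> {..<s} \<and> v \<in> {..<s} \<and> u \<noteq> v}
           \<union> {(u, v). u \<in> {s..<n} \<and> v \<in> {s..<n} \<and> u \<noteq> v}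
           \<union> {0} \<times> {s..<s + i} \<union> {s..<s + i} \<times> {0} \<rparr>"

lemma pair_graph_B_graph:
  assumes "0 < s" "s + i \<le> n"
  shows "pair_graph (B_graph n s i)"
proof -
  have sub: "parcs (B_graph n s i) \<subseteq> {..<n} \<times> {..<n}"
    using assms by (auto simp: B_graph_def)
  then have "finite (parcs (B_graph n s i))"
    by (rule finite_subset) simp
  then show ?thesis
    using sub assms by unfold_locales (auto simp: B_graph_def symmetric_def intro!: symI)
qed

lemma eigenvalue_adjacency_matrix:
  assumes "distinct vs" "set vs = pverts G"
  shows "eigenvalue (adjacency_matrix vs G) c \<longleftrightarrow>
    (\<exists>x. (\<exists>v\<in>pverts G. x v \<noteq> 0) \<and>
         (\<forall>v\<in>pverts G. (\<Sum>u\<in>pverts G. of_bool ((v, u) \<in> parcs G) * x u) = c * x v))"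
    (is "?L \<longleftrightarrow> ?R")
proof -
  let ?n = "length vs" and ?A = "adjacency_matrix vs G"
  have bij: "bij_betw (\<lambda>i. vs ! i) {0..<?n} (pverts G)"
    using assms by (intro bij_betw_nth) auto
  have row: "(?A *\<^sub>v vec ?n (\<lambda>i. x (vs ! i))) $ i
      = (\<Sum>u\<in>pverts G. of_bool ((vs ! i, u) \<in> parcs G) * x u)" if "i < ?n" for i x
    using that sum.reindex_bij_betw[OF bij, of "\<lambda>u. of_bool ((vs ! i, u) \<in> parcs G) * x u"]
    by (simp add: adjacency_matrix_def scalar_prod_def)
  have ev: "eigenvector ?A (vec ?n (\<lambda>i. x (vs ! i))) c \<longleftrightarrow>
      (\<exists>v\<in>pverts G. x v \<noteq> 0) \<and>
      (\<forall>v\<in>pverts G. (\<Sum>u\<in>pverts G. of_bool ((v, u) \<in> parcs G) * x u) = c * x v)" for x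
  proof -
    have "vec ?n (\<lambda>i. x (vs ! i)) = 0\<^sub>v ?n \<longleftrightarrow> (\<forall>v\<in>set vs. x v = 0)"
      unfolding all_set_conv_all_nth by (simp add: vec_eq_iff)
    moreover have "?A *\<^sub>v vec ?n (\<lambda>i. x (vs ! i)) = c \<cdot>\<^sub>v vec ?n (\<lambda>i. x (vs ! i)) \<longleftrightarrow>
        (\<forall>i<?n. (\<Sum>u\<in>pverts G. of_bool ((vs ! i, u) \<in> parcs G) * x u) = c * x (vs ! i))"
      using row[of _ x] by (simp add: vec_eq_iff adjacency_matrix_def)
    moreover have "\<dots> \<longleftrightarrow>
        (\<forall>v\<in>set vs. (\<Sum>u\<in>pverts G. of_bool ((v, u) \<in> parcs G) * x u) = c * x v)"
      unfolding all_set_conv_all_nth ..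
    ultimately show ?thesis
      unfolding eigenvector_def assms(2) by (simp add: adjacency_matrix_def)
  qed
  have "\<exists>x. y = vec ?n (\<lambda>i. x (vs ! i))" if "y \<in> carrier_vec ?n" for y :: "real vec"
  proof
    show "y = vec ?n (\<lambda>i. (\<lambda>v. y $ (the_inv_into {0..<?n} (\<lambda>i. vs ! i) v)) (vs ! i))"
      using that bij by (auto simp: bij_betw_def the_inv_into_f_f)
  qed
  then have "?L \<longleftrightarrow> (\<exists>x. eigenvector ?A (vec ?n (\<lambda>i. x (vs ! i))) c)"
    unfolding eigenvalue_def eigenvector_def by (metis adjacency_matrix_def dim_row_mat(1))
  then show ?thesis
    unfolding ev .
qed

lemma graph_rho_eq:
  assumes "distinct vs" "set vs = pverts G"
  shows "graph_rho G = Max (spectrum (adjacency_matrix vs G))"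
proof -
  have "distinct (vertex_list G) \<and> set (vertex_list G) = pverts G"
    unfolding vertex_list_def using assms by (metis (mono_tags, lifting) someI)
  then have "eigenvalue (adjacency_matrix (vertex_list G) G) c \<longleftrightarrow>
      eigenvalue (adjacency_matrix vs G) c" for c
    using eigenvalue_adjacency_matrix[of "vertex_list G" G c]
      eigenvalue_adjacency_matrix[OF assms, of c] by blast
  then show ?thesis
    unfolding graph_rho_def spectrum_def by presburger
qed

end

theory Submission
  imports Defs "HOL-Library.Disjoint_Sets"
begin

text \<open>
  Suppose that \<open>G\<close> has no \<open>k\<close> edge-disjoint spanning trees.  By the theorem of Tutte and
  Nash-Williams (\<open>spanning_forests_or_sparse_partition\<close>) its vertex set has a partition into \<open>p\<close>
  parts with fewer than \<open>k (p - 1)\<close> edges between different parts.  Then at least two parts have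
  fewer than \<open>2 k \<le> \<delta>\<close> edges leaving them, and the minimum degree forces such a part to have more
  than \<open>\<delta>\<close> vertices (\<open>two_large_parts\<close>).  The extremal graph contains a clique on \<open>n - \<delta> - 1\<close>
  vertices and is larger than it, so its spectral radius, and hence \<open>\<rho>(G)\<close>, exceeds \<open>n - \<delta> - 2\<close>.
  It remains to bound \<open>\<rho>(G)\<close> from above.

  All upper bounds come from one principle (\<open>graph_rho_le_supersolution\<close>): if a positive function
  \<open>y\<close> on the vertices satisfies \<open>A y \<le> c y\<close> pointwise, then \<open>\<rho>(G) \<le> c\<close>, and if \<open>\<rho>(G) = c\<close> and \<open>G\<close> is
  connected, then \<open>A y = c y\<close>.  In this way no eigenvector of \<open>G\<close> has to be estimated.

  If there are at least three parts, then \<open>G\<close> has few edges, because by convexity the number of edges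
  inside the parts is largest for one part with \<open>\<delta> + 1\<close> vertices, one large part and singletons.
  The degree plus a constant is then a supersolution for \<open>c = n - \<delta> - 2\<close>.
  If there are two parts, both with at least \<open>\<delta> + 2\<close> vertices, then one plus a multiple of the number
  of neighbours in the other part is a supersolution for the same \<open>c\<close>.

  The remaining case is two parts, one with exactly \<open>\<delta> + 1\<close> vertices, and at most \<open>k - 1\<close> edges
  between them; here the bound has to be sharp.  Let \<open>r - 1\<close> be the spectral radius of the extremal
  graph, which is known from an explicit eigenvector.  The values of this eigenvector can be
  redistributed according to where the edges between the parts are attached, and the result is a
  supersolution for \<open>c = r - 1\<close>.  It has no slack only if both parts are cliques and the \<open>k - 1\<close> edges
  form a star centred in the smaller part (\<open>star_if_no_slack\<close>), that is, if \<open>G\<close> is the extremal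
  graph.
\<close>

section \<open>Connection by a set of edges\<close>

text \<open>
  Edges are unordered pairs \<open>{x, y}\<close>, so that a set of edges needs no symmetry condition.
\<close>

definition linked :: "'a set set \<Rightarrow> 'a rel" where
  "linked F = {(x, y). {x, y} \<in> F}\<^sup>*"

definition component :: "'a set \<Rightarrow> 'a set set \<Rightarrow> 'a \<Rightarrow> 'a set" where
  "component V F x = {y \<in> V. (x, y) \<in> linked F}"

text \<open>
  A set of edges has no cycle iff each of its edges is a bridge.
\<close>

definition acyclic_edges :: "'a set set \<Rightarrow> bool" where
  "acyclic_edges F \<longleftrightarrow> (\<forall>a b. {a, b} \<in> F \<longrightarrow> (a, b) \<notin> linked (F - {{a, b}}))"

lemma linked_refl [simp]: "(x, x) \<in> linked F"
  by (simp add: linked_def)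

lemma linked_edge: "{x, y} \<in> F \<Longrightarrow> (x, y) \<in> linked F"
  by (auto simp: linked_def)

lemma linked_trans: "(x, y) \<in> linked F \<Longrightarrow> (y, z) \<in> linked F \<Longrightarrow> (x, z) \<in> linked F"
  unfolding linked_def by (rule rtrancl_trans)

lemma linked_sym: "(x, y) \<in> linked F \<Longrightarrow> (y, x) \<in> linked F"
proof -
  have "sym {(x, y). {x, y} \<in> F}"
    by (auto intro!: symI simp: insert_commute)
  then show "(x, y) \<in> linked F \<Longrightarrow> (y, x) \<in> linked F"
    unfolding linked_def using sym_rtrancl symD by metis
qed

lemma linked_mono: "F \<subseteq> F' \<Longrightarrow> linked F \<subseteq> linked F'"
  unfolding linked_def by (rule rtrancl_mono) auto

lemma linked_least:
  assumes "\<And>x y. {x, y} \<in> F \<Longrightarrow> (x, y) \<in> linked F'"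
  shows "linked F \<subseteq> linked F'"
proof -
  have "{(x, y). {x, y} \<in> F} \<subseteq> linked F'"
    using assms by auto
  then show ?thesis
    unfolding linked_def by (rule rtrancl_subset_rtrancl)
qed

lemma linked_insert_cases:
  assumes "(x, y) \<in> linked (insert {a, b} F)"
  shows "(x, y) \<in> linked F \<or> (x, a) \<in> linked F \<and> (b, y) \<in> linked F
    \<or> (x, b) \<in> linked F \<and> (a, y) \<in> linked F"
  using assms unfolding linked_def[of "insert {a, b} F"]
proof (induction rule: rtrancl_induct)
  case base
  then show ?case by simp
next
  case (step y z)
  from step.hyps(2) consider "{y, z} \<in> F" | "y = a" "z = b" | "y = b" "z = a"
    by (auto simp: doubleton_eq_iff)
  then show ?case
  proof cases
    case 1
    then have "(u, z) \<in> linked F" if "(u, y) \<in> linked F" for u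
      using that linked_edge linked_trans by metis
    then show ?thesis
      using step.IH by blast
  qed (use step.IH linked_refl in metis)+
qed

lemma acyclic_edges_subset:
  assumes "acyclic_edges F" "F' \<subseteq> F"
  shows "acyclic_edges F'"
  unfolding acyclic_edges_def
proof (intro allI impI notI)
  fix a b assume ab: "{a, b} \<in> F'" "(a, b) \<in> linked (F' - {{a, b}})"
  have "linked (F' - {{a, b}}) \<subseteq> linked (F - {{a, b}})"
    by (rule linked_mono) (use assms in auto)
  then show False
    using ab assms unfolding acyclic_edges_def by blast
qed

lemma acyclic_edges_insert:
  assumes F: "acyclic_edges F" and ab: "(a, b) \<notin> linked F"
  shows "acyclic_edges (insert {a, b} F)"
  unfolding acyclic_edges_def
proof (intro allI impI notI)
  fix c d
  assume cd: "{c, d} \<in> insert {a, b} F" "(c, d) \<in> linked (insert {a, b} F - {{c, d}})"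
  have sub: "linked (F - {{c, d}}) \<subseteq> linked F"
    by (rule linked_mono) auto
  show False
  proof (cases "{c, d} = {a, b}")
    case True
    then have "insert {a, b} F - {{c, d}} = F - {{c, d}}"
      by auto
    then have "(c, d) \<in> linked F"
      using cd sub by auto
    with True ab show False
      by (auto simp: doubleton_eq_iff dest: linked_sym)
  next
    case False
    then have mem: "{c, d} \<in> F" and "insert {a, b} F - {{c, d}} = insert {a, b} (F - {{c, d}})"
      using cd by auto
    then have "(c, d) \<in> linked (insert {a, b} (F - {{c, d}}))"
      using cd by simp
    from linked_insert_cases[OF this] show False
    proof (elim disjE conjE)
      assume "(c, d) \<in> linked (F - {{c, d}})"
      then show False using F mem by (auto simp: acyclic_edges_def)
    next
      assume "(c, a) \<in> linked (F - {{c, d}})" "(b, d) \<in> linked (F - {{c, d}})"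
      then show False
        using sub ab linked_edge[OF mem] by (meson linked_sym linked_trans subsetD)
    next
      assume "(c, b) \<in> linked (F - {{c, d}})" "(a, d) \<in> linked (F - {{c, d}})"
      then show False
        using sub ab linked_edge[OF mem] by (meson linked_sym linked_trans subsetD)
    qed
  qed
qed

lemma component_eq_iff:
  assumes "x \<in> V" "y \<in> V"
  shows "component V F x = component V F y \<longleftrightarrow> (x, y) \<in> linked F"
proof
  assume "component V F x = component V F y"
  then have "y \<in> component V F x"
    using assms by (simp add: component_def)
  then show "(x, y) \<in> linked F"
    by (simp add: component_def)
next
  assume "(x, y) \<in> linked F"
  then have "(x, z) \<in> linked F \<longleftrightarrow> (y, z) \<in> linked F" for z
    by (meson linked_sym linked_trans)
  then show "component V F x = component V F y"
    by (simp add: component_def)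
qed

lemma partition_on_components: "partition_on V (component V F ` V)"
proof (rule partition_onI)
  fix p q assume "p \<in> component V F ` V" "q \<in> component V F ` V" "p \<noteq> q"
  then obtain x y where V: "x \<in> V" "y \<in> V"
    and xy: "p = component V F x" "q = component V F y"
    by blast
  have "(x, y) \<notin> linked F"
    using \<open>p \<noteq> q\<close> component_eq_iff[OF V] unfolding xy by blast
  then show "disjnt p q"
    unfolding disjnt_iff xy component_def mem_Collect_eq
    by (meson linked_sym linked_trans)
next
  show "\<Union> (component V F ` V) = V"
    by (auto simp: component_def)
next
  show "{} \<notin> component V F ` V"
    by (force simp: component_def)
qed

text \<open>
  Adding an edge between two components merges exactly these two, so each edge of a forest lowers
  the number of components by one.
\<close>

lemma forest_card:
  assumes "finite V" "finite F"
    and "\<And>e. e \<in> F \<Longrightarrow> \<exists>a\<in>V. \<exists>b\<in>V. e = {a, b}"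
    and "acyclic_edges F"
  shows "card F + card (component V F ` V) = card V"
  using assms(2-4)
proof (induction F rule: finite_induct)
  case empty
  have "linked {} = Id"
    by (simp add: linked_def)
  then have "component V {} x = {x}" if "x \<in> V" for x
    using that by (auto simp: component_def)
  then have "inj_on (component V {}) V"
    by (auto simp: inj_on_def)
  then show ?case
    by (simp add: card_image)
next
  case (insert e F)
  obtain a b where ab: "a \<in> V" "b \<in> V" "e = {a, b}"
    using insert.prems(1) by blast
  have acyc: "acyclic_edges F"
    using acyclic_edges_subset insert.prems(2) by blast
  have IH: "card F + card (component V F ` V) = card V"
    using insert.IH insert.prems(1) acyc by blast
  have nab: "(a, b) \<notin> linked F"
    using insert.prems(2) insert.hyps(2) unfolding acyclic_edges_def ab(3)
    by (metis Diff_insert_absorb insertI1)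
  let ?A = "component V F a" and ?B = "component V F b" and ?F = "insert e F"
  have lab: "(a, b) \<in> linked ?F"
    unfolding ab(3) by (rule linked_edge) simp
  have sub: "linked F \<subseteq> linked ?F"
    by (rule linked_mono) auto
  have new: "component V ?F x = (if x \<in> ?A \<union> ?B then ?A \<union> ?B else component V F x)"
    if x: "x \<in> V" for x
  proof (cases "x \<in> ?A \<union> ?B")
    case True
    then have xa: "(x, a) \<in> linked F \<or> (x, b) \<in> linked F"
      by (auto simp: component_def dest: linked_sym)
    then have xa': "(x, a) \<in> linked ?F" "(x, b) \<in> linked ?F"
      using sub lab by (meson linked_sym linked_trans subsetD)+
    have "(x, y) \<in> linked ?F \<longleftrightarrow> (a, y) \<in> linked F \<or> (b, y) \<in> linked F" for y
    proof
      assume "(x, y) \<in> linked ?F"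
      then show "(a, y) \<in> linked F \<or> (b, y) \<in> linked F"
        using linked_insert_cases[of x y a b F] xa unfolding ab(3)
        by (meson linked_sym linked_trans)
    next
      assume "(a, y) \<in> linked F \<or> (b, y) \<in> linked F"
      then show "(x, y) \<in> linked ?F"
        using xa' sub by (meson linked_trans subsetD)
    qed
    then show ?thesis
      using True by (auto simp: component_def)
  next
    case False
    then have "(x, a) \<notin> linked F" "(x, b) \<notin> linked F"
      using x by (auto simp: component_def dest: linked_sym)
    then have "(x, y) \<in> linked ?F \<longleftrightarrow> (x, y) \<in> linked F" for y
      using linked_insert_cases[of x y a b F] sub unfolding ab(3) by blast
    then show ?thesis
      using False by (auto simp: component_def)
  qed
  have AB: "?A \<noteq> ?B"
    using nab component_eq_iff[OF ab(1,2)] by blast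
  have aA: "a \<in> ?A" and bB: "b \<in> ?B"
    using ab by (auto simp: component_def)
  have comp_old: "x \<in> ?A \<union> ?B \<longleftrightarrow> component V F x \<in> {?A, ?B}" if "x \<in> V" for x
    using that ab component_eq_iff[of x V a F] component_eq_iff[of x V b F]
    by (auto simp: component_def dest: linked_sym)
  have img: "component V ?F ` V = insert (?A \<union> ?B) (component V F ` V - {?A, ?B})"
  proof (intro equalityI subsetI)
    fix p assume "p \<in> component V ?F ` V"
    then obtain x where "x \<in> V" "p = component V ?F x" by auto
    then show "p \<in> insert (?A \<union> ?B) (component V F ` V - {?A, ?B})"
      using new comp_old by (cases "x \<in> ?A \<union> ?B") auto
  next
    fix p assume "p \<in> insert (?A \<union> ?B) (component V F ` V - {?A, ?B})"
    then consider "p = ?A \<union> ?B" | x where "x \<in> V" "p = component V F x" "p \<notin> {?A, ?B}"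
      by blast
    then show "p \<in> component V ?F ` V"
    proof cases
      case 1
      then have "p = component V ?F a" using new[OF ab(1)] aA by simp
      then show ?thesis using ab by blast
    next
      case 2
      then have "p = component V ?F x" using new comp_old by auto
      then show ?thesis using 2 by blast
    qed
  qed
  have "?A \<union> ?B \<notin> component V F ` V"
  proof
    assume "?A \<union> ?B \<in> component V F ` V"
    then obtain x where "component V F x = ?A \<union> ?B" by blast
    then have "a \<in> component V F x" "b \<in> component V F x"
      using aA bB by blast+
    then have "(x, a) \<in> linked F" "(x, b) \<in> linked F"
      by (simp_all add: component_def)
    with nab show False by (meson linked_sym linked_trans)
  qed
  moreover have "card (component V F ` V - {?A, ?B}) = card (component V F ` V) - 2"
    using ab AB assms(1) by (subst card_Diff_subset) auto
  moreover have "card {?A, ?B} \<le> card (component V F ` V)"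
    by (rule card_mono) (use ab assms(1) in auto)
  ultimately have "card (component V ?F ` V) + 1 = card (component V F ` V)"
    unfolding img using AB assms(1) by simp
  then show ?case
    using IH insert.hyps by simp
qed

text \<open>
  A minimal subset of a forest that still links two vertices is the path between them, and each of
  its edges separates the two vertices already in the whole forest: a detour around such an edge
  would close a cycle.
\<close>

lemma linked_by_separating_edges:
  assumes "acyclic_edges F" "finite F"
    and pairs: "\<And>e. e \<in> F \<Longrightarrow> \<exists>a b. e = {a, b}"
    and xy: "(x, y) \<in> linked F"
  shows "(x, y) \<in> linked {e \<in> F. (x, y) \<notin> linked (F - {e})}"
proof -
  let ?L = "{M. M \<subseteq> F \<and> (x, y) \<in> linked M}"
  have "finite ?L" "?L \<noteq> {}"
    using assms(2) xy by auto
  then obtain M where "M \<in> ?L" "\<forall>N\<in>?L. N \<subseteq> M \<longrightarrow> M = N"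
    using finite_has_minimal by meson
  then have M: "M \<subseteq> F" "(x, y) \<in> linked M"
    and minM: "\<And>N. N \<subseteq> F \<Longrightarrow> (x, y) \<in> linked N \<Longrightarrow> N \<subseteq> M \<Longrightarrow> N = M"
    by blast+
  have "(x, y) \<notin> linked (F - {e})" if e: "e \<in> M" for e
  proof
    assume detour: "(x, y) \<in> linked (F - {e})"
    obtain a b where ab: "e = {a, b}"
      using pairs M e by blast
    have "(x, y) \<notin> linked (M - {e})"
      using minM[of "M - {e}"] M e by auto
    moreover have "insert {a, b} (M - {e}) = M"
      using e ab by auto
    ultimately have "(x, a) \<in> linked (M - {e}) \<and> (b, y) \<in> linked (M - {e})
        \<or> (x, b) \<in> linked (M - {e}) \<and> (a, y) \<in> linked (M - {e})"
      using linked_insert_cases[of x y a b "M - {e}"] M by auto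
    moreover have "linked (M - {e}) \<subseteq> linked (F - {e})"
      by (rule linked_mono) (use M in auto)
    ultimately have "(a, b) \<in> linked (F - {e})"
      using detour by (meson linked_sym linked_trans subsetD)
    then show False
      using assms(1) e M ab by (auto simp: acyclic_edges_def)
  qed
  then have "linked M \<subseteq> linked {e \<in> F. (x, y) \<notin> linked (F - {e})}"
    using M by (intro linked_mono) auto
  then show ?thesis
    using M by blast
qed

section \<open>Packing spanning trees\<close>

definition forest_packing :: "'a set set \<Rightarrow> nat \<Rightarrow> (nat \<Rightarrow> 'a set set) \<Rightarrow> bool" where
  "forest_packing E k F \<longleftrightarrow>
     (\<forall>i<k. F i \<subseteq> E \<and> acyclic_edges (F i)) \<and> (\<forall>i<k. \<forall>j<k. i \<noteq> j \<longrightarrow> F i \<inter> F j = {})"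

lemma forest_packing_update:
  assumes "forest_packing E k F" "A \<subseteq> E" "acyclic_edges A"
    and "\<And>j. j < k \<Longrightarrow> j \<noteq> i \<Longrightarrow> A \<inter> F j = {}"
  shows "forest_packing E k (F(i := A))"
  unfolding forest_packing_def
proof (intro conjI allI impI)
  fix j l assume "j < k" "l < k" "j \<noteq> l"
  then show "(F(i := A)) j \<inter> (F(i := A)) l = {}"
    using assms(1) assms(4)[of j] assms(4)[of l]
    by (cases "j = i"; cases "l = i") (simp_all add: forest_packing_def Int_commute)
qed (use assms in \<open>simp_all add: forest_packing_def\<close>)

text \<open>
  A state of the exchange process is a packing together with an edge that it leaves uncovered.  A
  step puts that edge into one of the forests and drops an edge of the cycle that arises.
\<close>

inductive exchange_reachable ::
    "'a set set \<Rightarrow> nat \<Rightarrow> (nat \<Rightarrow> 'a set set) \<Rightarrow> (nat \<Rightarrow> 'a set set) \<Rightarrow> 'a set \<Rightarrow> bool"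
  for E k F\<^sub>0 where
  start: "e \<in> E \<Longrightarrow> (\<And>i. i < k \<Longrightarrow> e \<notin> F\<^sub>0 i) \<Longrightarrow> exchange_reachable E k F\<^sub>0 F\<^sub>0 e"
| swap: "exchange_reachable E k F\<^sub>0 F {x, y} \<Longrightarrow> i < k \<Longrightarrow> d \<in> F i \<Longrightarrow>
    (x, y) \<in> linked (F i) \<Longrightarrow> (x, y) \<notin> linked (F i - {d}) \<Longrightarrow>
    exchange_reachable E k F\<^sub>0 (F(i := insert {x, y} (F i) - {d})) d"

lemma exchange_reachable_packing:
  assumes "exchange_reachable E k F\<^sub>0 F e" "forest_packing E k F\<^sub>0"
    and fin: "finite E"
  shows "forest_packing E k F \<and> (\<Sum>i<k. card (F i)) = (\<Sum>i<k. card (F\<^sub>0 i))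
    \<and> e \<in> E \<and> (\<forall>i<k. e \<notin> F i)"
  using assms(1,2)
proof (induction rule: exchange_reachable.induct)
  case (start e)
  then show ?case by blast
next
  case (swap F x y i d)
  let ?e = "{x, y}" and ?F = "F(i := insert {x, y} (F i) - {d})"
  have IH: "forest_packing E k F" "(\<Sum>i<k. card (F i)) = (\<Sum>i<k. card (F\<^sub>0 i))"
    "?e \<in> E" "\<forall>i<k. ?e \<notin> F i"
    using swap by auto
  have Fi: "F i \<subseteq> E" "acyclic_edges (F i)" "finite (F i)"
    using IH(1) swap.hyps(2) fin by (auto simp: forest_packing_def intro: finite_subset)
  have ne: "?e \<noteq> d" "?e \<notin> F i"
    using IH(4) swap.hyps(2,3) by blast+
  then have eq: "insert ?e (F i) - {d} = insert ?e (F i - {d})"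
    by blast
  have "acyclic_edges (F i - {d})"
    using acyclic_edges_subset Fi by blast
  then have acyc: "acyclic_edges (insert ?e (F i) - {d})"
    unfolding eq by (rule acyclic_edges_insert) (rule swap.hyps(5))
  have "card (insert ?e (F i - {d})) = card (F i)"
    using ne Fi(3) swap.hyps(3) card_Suc_Diff1 by fastforce
  then have "card (?F j) = card (F j)" for j
    using eq by simp
  moreover have "forest_packing E k ?F"
  proof (rule forest_packing_update[OF IH(1) _ acyc])
    show "insert ?e (F i) - {d} \<subseteq> E"
      using Fi(1) IH(3) by blast
    show "(insert ?e (F i) - {d}) \<inter> F j = {}" if "j < k" "j \<noteq> i" for j
    proof -
      have "F i \<inter> F j = {}"
        using IH(1) swap.hyps(2) that by (simp add: forest_packing_def)
      then show ?thesis
        using IH(4) that(1) by blast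
    qed
  qed
  moreover have "d \<notin> F j" if "j < k" "j \<noteq> i" for j
    using IH(1) swap.hyps(2,3) that unfolding forest_packing_def by blast
  then have "d \<in> E" "\<forall>j<k. d \<notin> ?F j"
    using Fi swap.hyps(2,3) by auto
  ultimately show ?case
    using IH(2) by (simp del: fun_upd_apply)
qed

text \<open>
  Let \<open>R\<close> be the set of all edges that the process can uncover.  In a packing of maximum total size
  an uncovered edge closes a cycle in every forest, and all edges of these cycles lie in \<open>R\<close>.
  Hence a step does not change the components spanned by the edges in \<open>R\<close> of any forest, and
  these components are those of \<open>R\<close> itself.
\<close>

lemma linked_exchangeable:
  assumes pack: "forest_packing E k F\<^sub>0" and fin: "finite E"
    and pairs: "\<And>e. e \<in> E \<Longrightarrow> \<exists>a b. e = {a, b}"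
    and max: "\<And>F. forest_packing E k F \<Longrightarrow> (\<Sum>i<k. card (F i)) \<le> (\<Sum>i<k. card (F\<^sub>0 i))"
    and R: "R = {e. \<exists>F. exchange_reachable E k F\<^sub>0 F e}"
    and i: "i < k"
  shows "linked (F\<^sub>0 i \<inter> R) = linked R"
proof -
  have here: "(x, y) \<in> linked (F j \<inter> R)"
    if reach: "exchange_reachable E k F\<^sub>0 F {x, y}" and j: "j < k" for F x y j
  proof -
    note inv = exchange_reachable_packing[OF reach pack fin]
    have Fj: "F j \<subseteq> E" "acyclic_edges (F j)" "finite (F j)"
      using inv j fin by (auto simp: forest_packing_def intro: finite_subset)
    have xy: "(x, y) \<in> linked (F j)"
    proof (rule ccontr)
      assume not: "(x, y) \<notin> linked (F j)"
      let ?F = "F(j := insert {x, y} (F j))"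
      have "acyclic_edges (insert {x, y} (F j))"
        by (rule acyclic_edges_insert[OF Fj(2) not])
      then have "forest_packing E k ?F"
      proof (rule forest_packing_update[rotated 2])
        show "insert {x, y} (F j) \<inter> F l = {}" if "l < k" "l \<noteq> j" for l
        proof -
          have "F j \<inter> F l = {}"
            using inv j that by (simp add: forest_packing_def)
          then show ?thesis
            using inv that(1) by blast
        qed
      qed (use inv Fj(1) in auto)
      then have "(\<Sum>i<k. card (?F i)) \<le> (\<Sum>i<k. card (F i))"
        using max inv by metis
      moreover have "(\<Sum>i<k. card (F i)) < (\<Sum>i<k. card (?F i))"
        by (rule sum_strict_mono_ex1) (use inv j Fj(3) in auto)
      ultimately show False by simp
    qed
    have "(x, y) \<in> linked {d \<in> F j. (x, y) \<notin> linked (F j - {d})}"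
      by (rule linked_by_separating_edges) (use Fj pairs xy in auto)
    moreover have "{d \<in> F j. (x, y) \<notin> linked (F j - {d})} \<subseteq> F j \<inter> R"
      using exchange_reachable.swap[OF reach j _ xy] unfolding R by blast
    ultimately show ?thesis
      using linked_mono by blast
  qed
  have invar: "linked (F j \<inter> R) = linked (F\<^sub>0 j \<inter> R)"
    if "exchange_reachable E k F\<^sub>0 F e" "j < k" for F e j
    using that
  proof (induction rule: exchange_reachable.induct)
    case (swap F x y i d)
    show ?case
    proof (cases "j = i")
      case False
      then show ?thesis using swap by simp
    next
      case True
      let ?A = "F i \<inter> R"
      have dR: "d \<in> R"
        using exchange_reachable.swap[OF swap.hyps] unfolding R by blast
      have eR: "{x, y} \<in> R"
        using swap.hyps(1) unfolding R by blast
      have ne: "{x, y} \<noteq> d"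
        using exchange_reachable_packing[OF swap.hyps(1) pack fin] swap.hyps(2,3) by blast
      obtain a b where ab: "d = {a, b}"
        using exchange_reachable_packing[OF swap.hyps(1) pack fin] swap.hyps(2,3) pairs
        by (meson forest_packing_def subsetD)
      have upd: "(F(i := insert {x, y} (F i) - {d})) i \<inter> R = insert {x, y} (?A - {d})"
        using eR ne by auto
      have A: "insert {a, b} (?A - {d}) = ?A"
        using swap.hyps(3) dR ab by auto
      have "(x, y) \<in> linked (insert {a, b} (?A - {d}))"
        unfolding A by (rule here[OF swap.hyps(1,2)])
      moreover have "linked (?A - {d}) \<subseteq> linked (F i - {d})"
        by (rule linked_mono) auto
      then have "(x, y) \<notin> linked (?A - {d})"
        using swap.hyps(5) by blast
      ultimately have link: "(x, a) \<in> linked (?A - {d}) \<and> (b, y) \<in> linked (?A - {d})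
          \<or> (x, b) \<in> linked (?A - {d}) \<and> (a, y) \<in> linked (?A - {d})"
        using linked_insert_cases by metis
      let ?L = "linked (insert {x, y} (?A - {d}))"
      have "linked (?A - {d}) \<subseteq> ?L"
        by (rule linked_mono) auto
      moreover have "(x, y) \<in> ?L"
        by (rule linked_edge) simp
      ultimately have abL: "(a, b) \<in> ?L"
        using link by (meson linked_sym linked_trans subsetD)
      have "?L = linked ?A"
      proof (rule equalityI; rule linked_least)
        fix u v assume "{u, v} \<in> insert {x, y} (?A - {d})"
        then show "(u, v) \<in> linked ?A"
          using here[OF swap.hyps(1,2)]
          by (auto simp: doubleton_eq_iff dest: linked_sym intro: linked_edge)
      next
        fix u v assume "{u, v} \<in> ?A"
        then show "(u, v) \<in> ?L"
          using abL by (cases "{u, v} = d")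
            (auto simp: ab doubleton_eq_iff dest: linked_sym intro: linked_edge)
      qed
      then show ?thesis
        using True upd swap.IH swap.prems by simp
    qed
  qed simp
  show ?thesis
  proof (rule equalityI)
    show "linked (F\<^sub>0 i \<inter> R) \<subseteq> linked R"
      by (rule linked_mono) auto
    show "linked R \<subseteq> linked (F\<^sub>0 i \<inter> R)"
    proof (rule linked_least)
      fix x y assume "{x, y} \<in> R"
      then obtain F where "exchange_reachable E k F\<^sub>0 F {x, y}"
        unfolding R by blast
      then show "(x, y) \<in> linked (F\<^sub>0 i \<inter> R)"
        using here i invar by blast
    qed
  qed
qed

text \<open>
  The theorem of Tutte and Nash-Williams.  Take a packing of maximum total size and let \<open>R\<close> be the set
  of edges that exchanges can uncover.  Each forest restricted to \<open>R\<close> spans the components of \<open>R\<close>, so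
  it has \<open>card V - card P\<close> edges in \<open>R\<close>, where \<open>P\<close> is the set of these components.  An edge between
  different components is covered by a forest and lies outside \<open>R\<close>; counting these edges forest by
  forest shows that there are too few of them unless every forest is a spanning tree.
\<close>

lemma spanning_forests_or_sparse_partition:
  fixes V :: "'a set"
  assumes fin: "finite V" "V \<noteq> {}"
    and edges: "\<And>e. e \<in> E \<Longrightarrow> \<exists>a\<in>V. \<exists>b\<in>V. e = {a, b}"
  shows "(\<exists>F. forest_packing E k F \<and> (\<forall>i<k. \<forall>x\<in>V. \<forall>y\<in>V. (x, y) \<in> linked (F i))) \<or>
    (\<exists>P. partition_on V P \<and> card {e \<in> E. \<not> (\<exists>U\<in>P. e \<subseteq> U)} + k < k * card P)"
proof -
  have "E \<subseteq> Pow V"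
    using edges by blast
  then have finE: "finite E"
    using fin finite_subset by blast
  let ?size = "\<lambda>F. \<Sum>i<k. card (F i)"
  have "forest_packing E k (\<lambda>_. {})"
    by (auto simp: forest_packing_def acyclic_edges_def)
  moreover have "?size F \<le> k * card E" if "forest_packing E k F" for F
    using sum_bounded_above[of "{..<k}" "\<lambda>i. card (F i)" "card E"] that finE
    by (auto simp: forest_packing_def card_mono)
  ultimately obtain F\<^sub>0 where pack: "forest_packing E k F\<^sub>0"
    and max: "\<And>F. forest_packing E k F \<Longrightarrow> ?size F \<le> ?size F\<^sub>0"
    using ex_has_greatest_nat[of "forest_packing E k" "\<lambda>_. {}" ?size "Suc (k * card E)"]
    unfolding less_Suc_eq_le by blast
  have F: "F\<^sub>0 i \<subseteq> E" "acyclic_edges (F\<^sub>0 i)" "finite (F\<^sub>0 i)" if "i < k" for i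
    using pack that finE by (auto simp: forest_packing_def intro: finite_subset)
  have comps: "card A + card (component V A ` V) = card V" if "i < k" "A \<subseteq> F\<^sub>0 i" for i A
  proof (rule forest_card)
    show "finite A" using F[OF that(1)] that(2) finite_subset by blast
    show "acyclic_edges A" using F[OF that(1)] that(2) acyclic_edges_subset by blast
    show "\<exists>a\<in>V. \<exists>b\<in>V. e = {a, b}" if "e \<in> A" for e
      using edges F(1)[OF \<open>i < k\<close>] \<open>A \<subseteq> F\<^sub>0 i\<close> that by blast
  qed (rule fin)
  have pos: "card (component V A ` V) \<ge> 1" for A
    using fin by (simp add: Suc_le_eq card_gt_0_iff)
  show ?thesis
  proof (cases "?size F\<^sub>0 < k * (card V - 1)")
    case False
    have le: "card (F\<^sub>0 i) \<le> card V - 1" if "i < k" for i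
      using comps[OF that subset_refl] pos[of "F\<^sub>0 i"] by linarith
    have size_eq: "card (F\<^sub>0 i) = card V - 1" if "i < k" for i
    proof (rule ccontr)
      assume "card (F\<^sub>0 i) \<noteq> card V - 1"
      then have "?size F\<^sub>0 < (\<Sum>i<k. card V - 1)"
        by (intro sum_strict_mono_ex1) (use le that in \<open>auto simp: order.strict_iff_order\<close>)
      then show False using False by simp
    qed
    have one: "card (component V (F\<^sub>0 i) ` V) = 1" if "i < k" for i
      using comps[OF that subset_refl] size_eq[OF that] fin
      by (cases "card V") auto
    have "(x, y) \<in> linked (F\<^sub>0 i)" if "i < k" "x \<in> V" "y \<in> V" for i x y
    proof -
      obtain C where "component V (F\<^sub>0 i) ` V = {C}"
        using one[OF \<open>i < k\<close>] card_1_singletonE by blast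
      then have "component V (F\<^sub>0 i) x = component V (F\<^sub>0 i) y"
        using \<open>x \<in> V\<close> \<open>y \<in> V\<close> by blast
      then show ?thesis
        using component_eq_iff[OF \<open>x \<in> V\<close> \<open>y \<in> V\<close>] by blast
    qed
    then show ?thesis
      using pack by blast
  next
    case True
    define R where "R = {e. \<exists>F. exchange_reachable E k F\<^sub>0 F e}"
    let ?P = "component V R ` V"
    have lR: "linked (F\<^sub>0 i \<inter> R) = linked R" if "i < k" for i
      by (rule linked_exchangeable[OF pack finE _ max R_def that]) (use edges in blast)
    have cR: "card (F\<^sub>0 i \<inter> R) + card ?P = card V" if "i < k" for i
    proof -
      have "component V (F\<^sub>0 i \<inter> R) = component V R"
        using lR[OF that] by (auto simp: component_def fun_eq_iff)
      then show ?thesis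
        using comps[OF that, of "F\<^sub>0 i \<inter> R"] by simp
    qed
    \<comment> \<open>An edge across the partition lies outside \<open>R\<close>, so it is covered by some forest.\<close>
    have "{e \<in> E. \<not> (\<exists>U\<in>?P. e \<subseteq> U)} \<subseteq> (\<Union>i<k. F\<^sub>0 i - R)"
    proof
      fix e assume "e \<in> {e \<in> E. \<not> (\<exists>U\<in>?P. e \<subseteq> U)}"
      then have e: "e \<in> E" "\<And>x. x \<in> V \<Longrightarrow> \<not> e \<subseteq> component V R x"
        by auto
      obtain a b where ab: "a \<in> V" "b \<in> V" "e = {a, b}"
        using edges[OF e(1)] by blast
      have eR: "e \<notin> R"
        using ab e(2)[OF ab(1)] linked_edge[of a b R] by (auto simp: component_def)
      have "\<exists>i<k. e \<in> F\<^sub>0 i"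
      proof (rule ccontr)
        assume "\<not> (\<exists>i<k. e \<in> F\<^sub>0 i)"
        then have "exchange_reachable E k F\<^sub>0 F\<^sub>0 e"
          using e(1) by (intro exchange_reachable.start) auto
        then show False
          using eR unfolding R_def by blast
      qed
      then show "e \<in> (\<Union>i<k. F\<^sub>0 i - R)"
        using eR by blast
    qed
    then have "card {e \<in> E. \<not> (\<exists>U\<in>?P. e \<subseteq> U)} \<le> card (\<Union>i<k. F\<^sub>0 i - R)"
      using F by (intro card_mono) auto
    also have "\<dots> \<le> (\<Sum>i<k. card (F\<^sub>0 i - R))"
      by (rule card_UN_le) simp
    finally have cross: "card {e \<in> E. \<not> (\<exists>U\<in>?P. e \<subseteq> U)} \<le> (\<Sum>i<k. card (F\<^sub>0 i - R))" .
    have "card (F\<^sub>0 i - R) + card V = card (F\<^sub>0 i) + card ?P" if "i < k" for i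
      using cR[OF that] F(3)[OF that] card_Int_Diff[of "F\<^sub>0 i" R] by linarith
    then have "(\<Sum>i<k. card (F\<^sub>0 i - R) + card V) = (\<Sum>i<k. card (F\<^sub>0 i) + card ?P)"
      by (intro sum.cong) auto
    then have "(\<Sum>i<k. card (F\<^sub>0 i - R)) + k * card V = ?size F\<^sub>0 + k * card ?P"
      by (simp add: sum.distrib)
    moreover have "?size F\<^sub>0 + k < k * card V"
      using True fin by (cases "card V") auto
    ultimately have "card {e \<in> E. \<not> (\<exists>U\<in>?P. e \<subseteq> U)} + k < k * card ?P"
      using cross by linarith
    then show ?thesis
      using partition_on_components by blast
  qed
qed

definition graph_edges :: "'a pair_pre_digraph \<Rightarrow> 'a set set" where
  "graph_edges G = (\<lambda>(u, v). {u, v}) ` parcs G"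

definition edge_subgraph :: "'a set \<Rightarrow> 'a set set \<Rightarrow> 'a pair_pre_digraph" where
  "edge_subgraph V F = \<lparr> pverts = V, parcs = {(u, v). {u, v} \<in> F} \<rparr>"

lemma pawalk_verts_eq: "pcas u p v \<Longrightarrow> pawalk_verts u p = u # map snd p"
  by (induction p arbitrary: u) auto

lemma pcas_append: "pcas u (p @ q) v \<longleftrightarrow> (\<exists>w. pcas u p w \<and> pcas w q v)"
  by (induction p arbitrary: u) auto

lemma pcas_last: "pcas u p v \<Longrightarrow> p \<noteq> [] \<Longrightarrow> snd (last p) = v"
  by (induction p arbitrary: u) auto

lemma linked_pcas:
  assumes "pcas u p v" "\<And>x y. (x, y) \<in> set p \<Longrightarrow> {x, y} \<in> F"
  shows "(u, v) \<in> linked F"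
  using assms
proof (induction p arbitrary: u)
  case (Cons a p)
  then have "(u, snd a) \<in> linked F" "(snd a, v) \<in> linked F"
    by (auto intro!: linked_edge)
  then show ?case by (rule linked_trans)
qed simp

text \<open>
  A closed walk of length at least three with distinct vertices uses the edge of its first arc only
  once, so the rest of the walk is a detour around that edge.
\<close>

lemma acyclic_edges_no_cycle:
  assumes acyc: "acyclic_edges F" and cyc: "pcas u p u" "distinct (tl (pawalk_verts u p))"
    and sub: "\<And>x y. (x, y) \<in> set p \<Longrightarrow> {x, y} \<in> F"
    and len: "length p \<ge> 3"
  shows False
proof -
  obtain v q where p: "p = (u, v) # q"
    using len cyc(1) by (cases p) auto
  have q: "pcas v q u" "length q \<ge> 2"
    using len cyc(1) p by auto
  have dist: "distinct (v # map snd q)"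
    using cyc(2) pawalk_verts_eq[OF q(1)] p by simp
  have "{x, y} \<noteq> {u, v}" if xy: "(x, y) \<in> set q" for x y
  proof
    assume "{x, y} = {u, v}"
    moreover have "y \<noteq> v"
      using xy dist by force
    ultimately have eq: "x = v" "y = u"
      by (auto simp: doubleton_eq_iff)
    obtain q1 q2 where q12: "q = q1 @ (v, u) # q2"
      using xy eq split_list by metis
    then have walk: "pcas v q1 v" "pcas u q2 u"
      using q(1) by (auto simp: pcas_append)
    have "q1 = []"
    proof (rule ccontr)
      assume ne: "q1 \<noteq> []"
      then have "v \<in> set (map snd q1)"
        using pcas_last[OF walk(1) ne] last_in_set[OF ne] by force
      then show False
        using dist q12 by simp
    qed
    moreover have "q2 = []"
    proof (rule ccontr)
      assume ne: "q2 \<noteq> []"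
      then have "u \<in> set (map snd q2)"
        using pcas_last[OF walk(2) ne] last_in_set[OF ne] by force
      then show False
        using dist q12 by simp
    qed
    ultimately show False
      using q(2) q12 by simp
  qed
  then have "(v, u) \<in> linked (F - {{u, v}})"
    using sub p by (intro linked_pcas[OF q(1)]) auto
  then have "(u, v) \<in> linked (F - {{u, v}})"
    by (rule linked_sym)
  moreover have "{u, v} \<in> F"
    using sub p by simp
  ultimately show False
    using acyc by (auto simp: acyclic_edges_def)
qed

lemma undirected_spanning_tree_edge_subgraph:
  assumes G: "pair_graph G" and ne: "pverts G \<noteq> {}"
    and F: "F \<subseteq> graph_edges G" "acyclic_edges F"
    and conn: "\<And>x y. x \<in> pverts G \<Longrightarrow> y \<in> pverts G \<Longrightarrow> (x, y) \<in> linked F"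
  shows "undirected_spanning_tree (edge_subgraph (pverts G) F) G"
proof -
  interpret G: pair_graph G by (rule G)
  let ?T = "edge_subgraph (pverts G) F"
  have symG: "(v, u) \<in> parcs G" if "(u, v) \<in> parcs G" for u v
    using G.pair_sym_arcs that by (auto simp: symmetric_def dest: symD)
  have arcs: "parcs ?T \<subseteq> parcs G"
  proof
    fix e assume "e \<in> parcs ?T"
    then obtain u v where e: "e = (u, v)" "{u, v} \<in> graph_edges G"
      using F(1) by (auto simp: edge_subgraph_def)
    then obtain a b where "(a, b) \<in> parcs G" "{u, v} = {a, b}"
      by (auto simp: graph_edges_def)
    then show "e \<in> parcs G"
      using symG e(1) by (auto simp: doubleton_eq_iff)
  qed
  have symT: "(v, u) \<in> parcs ?T" if "(u, v) \<in> parcs ?T" for u v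
    using that by (simp add: edge_subgraph_def insert_commute)
  have T: "pair_graph ?T"
  proof unfold_locales
    show "finite (parcs ?T)"
      using arcs G.pair_finite_arcs finite_subset by blast
    show "symmetric (with_proj ?T)"
      using symT by (auto simp: symmetric_def intro!: symI)
    show "finite (pverts ?T)"
      using G.pair_finite_verts by (simp add: edge_subgraph_def)
  next
    fix e assume "e \<in> parcs ?T"
    then have e: "e \<in> parcs G" using arcs by blast
    show "fst e \<in> pverts ?T" "snd e \<in> pverts ?T" "fst e \<noteq> snd e"
      using G.arc_fst_in_verts[OF e] G.arc_snd_in_verts[OF e] G.pair_no_loops[OF e]
      by (simp_all add: edge_subgraph_def)
  qed
  have mk: "parcs (mk_symmetric (with_proj ?T)) = {(u, v). {u, v} \<in> F}"
    by (auto simp: mk_symmetric_def edge_subgraph_def insert_commute)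
  have "Digraph_Component.connected (with_proj ?T)"
    unfolding connected_def strongly_connected_def
  proof (intro conjI ballI)
    show "verts (with_proj (mk_symmetric (with_proj ?T))) \<noteq> {}"
      using ne by (simp add: mk_symmetric_def edge_subgraph_def)
    fix u v
    assume "u \<in> verts (with_proj (mk_symmetric (with_proj ?T)))"
      "v \<in> verts (with_proj (mk_symmetric (with_proj ?T)))"
    then have uv: "u \<in> pverts G" "v \<in> pverts G"
      by (simp_all add: mk_symmetric_def edge_subgraph_def)
    have "(u, v) \<in> {(u, v). {u, v} \<in> F}\<^sup>*"
      using conn[OF uv] by (simp add: linked_def)
    then have "(u, v) \<in> rtrancl_on (pverts G) {(u, v). {u, v} \<in> F}"
    proof (rule rtrancl_consistent_rtrancl_on[OF _ uv])
      fix a b assume "(a, b) \<in> {(u, v). {u, v} \<in> F}"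
      then have "(a, b) \<in> parcs G" using arcs by (auto simp: edge_subgraph_def)
      then show "b \<in> pverts G" by (rule G.in_arcsD2)
    qed
    then show "u \<rightarrow>\<^sup>*\<^bsub>with_proj (mk_symmetric (with_proj ?T))\<^esub> v"
      unfolding reachable_def with_proj_simps mk
      by (simp add: mk_symmetric_def edge_subgraph_def)
  qed
  moreover have "\<not> (\<exists>p. pre_digraph.cycle (with_proj ?T) p \<and> length p \<ge> 3)"
  proof
    assume "\<exists>p. pre_digraph.cycle (with_proj ?T) p \<and> length p \<ge> 3"
    then obtain p u where "pcas u p u" "distinct (tl (pawalk_verts u p))" "set p \<subseteq> parcs ?T"
      "length p \<ge> 3"
      unfolding pre_digraph.cycle_def pre_digraph.awalk_def
      by (auto simp: cas_with_proj_eq awalk_verts_with_proj_eq)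
    then show False
      using acyclic_edges_no_cycle[OF F(2), of u p] by (auto simp: edge_subgraph_def)
  qed
  moreover have "spanning (with_proj ?T) (with_proj G)"
    unfolding spanning_def subgraph_def wf_digraph_wp_iff compatible_def
    using arcs G.pair_wf_digraph_axioms pair_graph.axioms(1)[OF T]
    by (auto simp: edge_subgraph_def pair_digraph_def pair_fin_digraph_def)
  ultimately show ?thesis
    using T by (simp add: undirected_spanning_tree_def undirected_tree_def)
qed

lemma card_packing_le_packing_number:
  assumes G: "pair_graph G" and pack: "spanning_tree_packing \<T> G"
  shows "card \<T> \<le> spanning_tree_packing_number G"
proof -
  interpret G: pair_graph G by (rule G)
  let ?S = "(\<lambda>A. \<lparr> pverts = pverts G, parcs = A \<rparr>) ` Pow (parcs G)"
  have fin: "finite ?S"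
    using G.pair_finite_arcs by simp
  have sub: "\<S> \<subseteq> ?S" if "spanning_tree_packing \<S> G" for \<S>
  proof
    fix T assume "T \<in> \<S>"
    then have "spanning (with_proj T) (with_proj G)"
      using that by (auto simp: spanning_tree_packing_def undirected_spanning_tree_def)
    then have "pverts T = pverts G" "parcs T \<subseteq> parcs G"
      by (auto simp: spanning_def subgraph_def)
    then show "T \<in> ?S"
      by (intro image_eqI[of _ _ "parcs T"]) auto
  qed
  have "{card \<S> | \<S>. spanning_tree_packing \<S> G} \<subseteq> card ` Pow ?S"
    using sub by blast
  then have "finite {card \<S> | \<S>. spanning_tree_packing \<S> G}"
    by (rule finite_subset) (use fin in simp)
  then show ?thesis
    unfolding spanning_tree_packing_number_def using pack by (intro Max_ge) auto
qed

lemma packing_number_ge_forest_packing: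
  assumes G: "pair_graph G" and card: "card (pverts G) \<ge> 2"
    and pack: "forest_packing (graph_edges G) k F"
    and conn: "\<And>i x y. i < k \<Longrightarrow> x \<in> pverts G \<Longrightarrow> y \<in> pverts G \<Longrightarrow> (x, y) \<in> linked (F i)"
  shows "k \<le> spanning_tree_packing_number G"
proof -
  let ?V = "pverts G" and ?T = "\<lambda>i. edge_subgraph (pverts G) (F i)"
  have F: "F i \<subseteq> graph_edges G" "acyclic_edges (F i)" if "i < k" for i
    using pack that by (auto simp: forest_packing_def)
  have disj: "parcs (?T i) \<inter> parcs (?T j) = {}" if "i < k" "j < k" "i \<noteq> j" for i j
  proof -
    have "F i \<inter> F j = {}"
      using pack that by (simp add: forest_packing_def)
    then show ?thesis
      by (auto simp: edge_subgraph_def)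
  qed
  have fin: "finite ?V"
    using card by (intro card_ge_0_finite) simp
  \<comment> \<open>Distinct indices give distinct trees, because a tree on two or more vertices has an edge.\<close>
  obtain x y where xy: "x \<in> ?V" "y \<in> ?V" "x \<noteq> y"
    using card card_le_Suc0_iff_eq[OF fin] by auto
  have ne: "parcs (?T i) \<noteq> {}" if "i < k" for i
  proof
    assume "parcs (?T i) = {}"
    then have "{(u, v). {u, v} \<in> F i} = {}"
      by (simp add: edge_subgraph_def)
    then have "linked (F i) = Id"
      unfolding linked_def by simp
    then show False
      using conn[OF that xy(1,2)] xy(3) by simp
  qed
  have "inj_on ?T {..<k}"
  proof (rule inj_onI)
    fix i j assume "i \<in> {..<k}" "j \<in> {..<k}" "?T i = ?T j"
    then show "i = j"
      using disj[of i j] ne[of i] by auto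
  qed
  then have "card (?T ` {..<k}) = k"
    by (simp add: card_image)
  moreover have "spanning_tree_packing (?T ` {..<k}) G"
    unfolding spanning_tree_packing_def
  proof (intro conjI ballI)
    fix T assume "T \<in> ?T ` {..<k}"
    then obtain i where i: "i < k" "T = ?T i" by auto
    show "undirected_spanning_tree T G"
      unfolding i(2)
      by (rule undirected_spanning_tree_edge_subgraph[OF G _ F[OF i(1)] conn[OF i(1)]])
        (use xy in auto)
  next
    show "pairwise (\<lambda>S T. parcs S \<inter> parcs T = {}) (?T ` {..<k})"
      unfolding pairwise_def
    proof (intro ballI impI)
      fix S T assume "S \<in> ?T ` {..<k}" "T \<in> ?T ` {..<k}" "S \<noteq> T"
      then obtain i j where "i < k" "j < k" "S = ?T i" "T = ?T j" "i \<noteq> j" by auto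
      then show "parcs S \<inter> parcs T = {}" using disj by simp
    qed
  qed
  ultimately show ?thesis
    using card_packing_le_packing_number[OF G] by metis
qed

section \<open>Eigenvalues of graphs\<close>

text \<open>
  Compare an eigenvector \<open>x\<close> with the positive function \<open>y\<close> at a vertex where \<open>\<bar>x v\<bar> / y v\<close> is
  largest.  If \<open>l = c\<close>, then the maximum is also attained at all neighbours of such a vertex, hence
  everywhere in a connected graph, and there is no slack at any vertex.
\<close>

lemma eigenvalue_le_supersolution:
  fixes x y :: "'a \<Rightarrow> real"
  assumes fin: "finite V" and A: "A \<subseteq> V \<times> V"
    and pos: "\<And>v. v \<in> V \<Longrightarrow> 0 < y v"
    and super: "\<And>v. v \<in> V \<Longrightarrow> (\<Sum>u\<in>A `` {v}. y u) \<le> c * y v"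
    and eig: "\<And>v. v \<in> V \<Longrightarrow> (\<Sum>u\<in>A `` {v}. x u) = l * x v"
    and nz: "w \<in> V" "x w \<noteq> 0"
  shows "l \<le> c"
    and "l = c \<Longrightarrow> (\<And>u v. u \<in> V \<Longrightarrow> v \<in> V \<Longrightarrow> (u, v) \<in> A\<^sup>*) \<Longrightarrow> v \<in> V \<Longrightarrow>
      (\<Sum>u\<in>A `` {v}. y u) = c * y v"
proof -
  define M where "M = Max ((\<lambda>v. \<bar>x v\<bar> / y v) ` V)"
  have fin': "finite ((\<lambda>v. \<bar>x v\<bar> / y v) ` V)" "(\<lambda>v. \<bar>x v\<bar> / y v) ` V \<noteq> {}"
    using fin nz by auto
  have le: "\<bar>x u\<bar> \<le> M * y u" if "u \<in> V" for u
  proof -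
    have "\<bar>x u\<bar> / y u \<le> M"
      unfolding M_def using fin' that by (intro Max_ge) auto
    then show ?thesis
      using pos[OF that] by (simp add: pos_divide_le_eq)
  qed
  obtain m where m: "m \<in> V" "M = \<bar>x m\<bar> / y m"
    using Max_in[OF fin'] unfolding M_def by blast
  then have m': "\<bar>x m\<bar> = M * y m"
    using pos[OF m(1)] by simp
  have "0 < \<bar>x w\<bar> / y w"
    using nz pos by simp
  also have "\<dots> \<le> M"
    unfolding M_def using fin' nz by (intro Max_ge) auto
  finally have M: "0 < M" .
  have nb: "A `` {v} \<subseteq> V" "finite (A `` {v})" for v
    using A fin by (auto intro: finite_subset)
  have chain: "l * \<bar>x v\<bar> \<le> (\<Sum>u\<in>A `` {v}. \<bar>x u\<bar>)"
    "(\<Sum>u\<in>A `` {v}. \<bar>x u\<bar>) \<le> (\<Sum>u\<in>A `` {v}. M * y u)"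
    "(\<Sum>u\<in>A `` {v}. M * y u) \<le> c * (M * y v)" if v: "v \<in> V" for v
  proof -
    have "l * \<bar>x v\<bar> \<le> \<bar>l * x v\<bar>"
      by (simp add: abs_mult mult_right_mono)
    also have "\<dots> \<le> (\<Sum>u\<in>A `` {v}. \<bar>x u\<bar>)"
      unfolding eig[OF v, symmetric] by (rule sum_abs)
    finally show "l * \<bar>x v\<bar> \<le> (\<Sum>u\<in>A `` {v}. \<bar>x u\<bar>)" .
    show "(\<Sum>u\<in>A `` {v}. \<bar>x u\<bar>) \<le> (\<Sum>u\<in>A `` {v}. M * y u)"
      using le nb by (intro sum_mono) auto
    show "(\<Sum>u\<in>A `` {v}. M * y u) \<le> c * (M * y v)"
      using mult_left_mono[OF super[OF v], of M] M
      by (simp add: sum_distrib_left[symmetric] mult_ac)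
  qed
  have "l * \<bar>x m\<bar> \<le> c * \<bar>x m\<bar>"
    using chain[OF m(1)] unfolding m' by linarith
  moreover have "0 < \<bar>x m\<bar>"
    using m' M pos[OF m(1)] by simp
  ultimately show "l \<le> c"
    by simp
  assume lc: "l = c" and conn: "\<And>u v. u \<in> V \<Longrightarrow> v \<in> V \<Longrightarrow> (u, v) \<in> A\<^sup>*" and "v \<in> V"
  have spread: "\<bar>x u\<bar> = M * y u" if "v \<in> V" "\<bar>x v\<bar> = M * y v" "u \<in> A `` {v}" for u v
  proof (rule ccontr)
    assume "\<bar>x u\<bar> \<noteq> M * y u"
    then have "\<bar>x u\<bar> < M * y u"
      using le[of u] that nb(1) by fastforce
    then have "(\<Sum>u\<in>A `` {v}. \<bar>x u\<bar>) < (\<Sum>u\<in>A `` {v}. M * y u)"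
      using that nb le by (intro sum_strict_mono_ex1) auto
    then show False
      using chain[OF that(1)] that(2) lc by simp
  qed
  have "v \<in> V \<and> \<bar>x v\<bar> = M * y v"
    using conn[OF m(1) \<open>v \<in> V\<close>]
  proof (induction rule: rtrancl_induct)
    case base
    then show ?case using m m' by simp
  next
    case (step u v)
    then show ?case using spread[of u v] A by auto
  qed
  then have "(\<Sum>u\<in>A `` {v}. M * y u) = c * (M * y v)"
    using chain[of v] lc by simp
  then have "M * (\<Sum>u\<in>A `` {v}. y u) = M * (c * y v)"
    by (simp add: sum_distrib_left[symmetric] mult_ac)
  then show "(\<Sum>u\<in>A `` {v}. y u) = c * y v"
    using M by simp
qed

lemma sum_neighbours:
  fixes x :: "'a \<Rightarrow> real"
  assumes "finite V" "A \<subseteq> V \<times> V"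
  shows "(\<Sum>u\<in>V. of_bool ((v, u) \<in> A) * x u) = (\<Sum>u\<in>A `` {v}. x u)"
proof -
  have "(\<Sum>u\<in>V. of_bool ((v, u) \<in> A) * x u) = (\<Sum>u\<in>V \<inter> {u. (v, u) \<in> A}. x u)"
    using assms(1) by (simp add: sum.inter_restrict of_bool_def if_distrib[of "\<lambda>a. a * _"] cong: if_cong)
  also have "V \<inter> {u. (v, u) \<in> A} = A `` {v}"
    using assms(2) by auto
  finally show ?thesis .
qed

text \<open>
  A complex eigenvalue exists, and pairing its eigenvector with its conjugate shows that it is real;
  then the real or the imaginary part of the eigenvector is a real eigenvector.
\<close>

lemma symmetric_real_mat_eigenvalue:
  fixes A :: "real mat"
  assumes A: "A \<in> carrier_mat n n" and n: "n > 0"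
    and sym: "\<And>i j. i < n \<Longrightarrow> j < n \<Longrightarrow> A $$ (i, j) = A $$ (j, i)"
  shows "\<exists>l. eigenvalue A l"
proof -
  let ?C = "map_mat complex_of_real A"
  have C: "?C \<in> carrier_mat n n" using A by simp
  obtain \<mu> where "eigenvalue ?C \<mu>"
    using spectrum_non_empty[OF C n] by (auto simp: spectrum_def)
  then obtain z where z: "z \<in> carrier_vec n" "z \<noteq> 0\<^sub>v n" "?C *\<^sub>v z = \<mu> \<cdot>\<^sub>v z"
    using C by (auto simp: eigenvalue_def eigenvector_def)
  have row: "(\<Sum>j<n. of_real (A $$ (i, j)) * z $ j) = \<mu> * z $ i" if "i < n" for i
  proof -
    have "(?C *\<^sub>v z) $ i = (\<Sum>j<n. of_real (A $$ (i, j)) * z $ j)"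
      using that A z(1) by (auto simp: scalar_prod_def lessThan_atLeast0 intro!: sum.cong)
    then show ?thesis using z(1,3) that by simp
  qed
  define N where "N = (\<Sum>i<n. cnj (z $ i) * z $ i)"
  have N: "N = of_real (\<Sum>i<n. (cmod (z $ i))\<^sup>2)"
    unfolding N_def of_real_sum
    by (intro sum.cong refl) (metis complex_norm_square mult.commute of_real_power)
  obtain i where i: "i < n" "z $ i \<noteq> 0"
    using z(1,2) by (auto simp: vec_eq_iff)
  have "(\<Sum>i<n. (cmod (z $ i))\<^sup>2) > 0"
    by (rule sum_pos2[of _ i]) (use i in auto)
  then have N0: "N \<noteq> 0" unfolding N by (simp del: of_real_sum)
  have eq: "\<mu> * N = (\<Sum>i<n. \<Sum>j<n. cnj (z $ i) * of_real (A $$ (i, j)) * z $ j)"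
    unfolding N_def sum_distrib_left
  proof (rule sum.cong)
    fix i assume "i \<in> {..<n}"
    then have "\<mu> * (cnj (z $ i) * z $ i) = cnj (z $ i) * (\<Sum>j<n. of_real (A $$ (i, j)) * z $ j)"
      using row by simp
    then show "\<mu> * (cnj (z $ i) * z $ i) = (\<Sum>j<n. cnj (z $ i) * of_real (A $$ (i, j)) * z $ j)"
      by (simp add: sum_distrib_left mult.assoc)
  qed simp
  have "cnj (\<Sum>i<n. \<Sum>j<n. cnj (z $ i) * of_real (A $$ (i, j)) * z $ j)
      = (\<Sum>i<n. \<Sum>j<n. cnj (z $ j) * of_real (A $$ (i, j)) * z $ i)"
    by (simp add: cnj_sum mult_ac)
  also have "\<dots> = (\<Sum>j<n. \<Sum>i<n. cnj (z $ j) * of_real (A $$ (i, j)) * z $ i)"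
    by (rule sum.swap)
  also have "\<dots> = (\<Sum>i<n. \<Sum>j<n. cnj (z $ i) * of_real (A $$ (i, j)) * z $ j)"
    using sym by (intro sum.cong refl) auto
  finally have "cnj (\<mu> * N) = \<mu> * N"
    unfolding eq .
  then have "cnj \<mu> * N = \<mu> * N"
    unfolding N by (simp del: of_real_sum of_real_power)
  then have "cnj \<mu> = \<mu>" using N0 by simp
  then have im: "Im \<mu> = 0" by (simp add: complex_eq_iff)
  have eig: "eigenvalue A (Re \<mu>)"
    if part: "p = Re \<or> p = Im" and i: "i < n" "p (z $ i) \<noteq> 0" for p i
  proof -
    let ?x = "vec n (\<lambda>i. p (z $ i))"
    have "(\<Sum>j<n. A $$ (i, j) * p (z $ j)) = Re \<mu> * p (z $ i)" if "i < n" for i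
      using arg_cong[OF row[OF that], of p] part im by (auto simp: Re_sum Im_sum)
    then have "A *\<^sub>v ?x = Re \<mu> \<cdot>\<^sub>v ?x"
      using A by (intro eq_vecI) (auto simp: scalar_prod_def lessThan_atLeast0)
    moreover have "?x \<noteq> 0\<^sub>v n"
      using i by (auto simp: vec_eq_iff)
    ultimately have "eigenvector A ?x (Re \<mu>)"
      using A by (auto simp: eigenvector_def)
    then show ?thesis
      unfolding eigenvalue_def by blast
  qed
  show ?thesis
    using eig[of Re i] eig[of Im i] i by (auto simp: complex_eq_iff)
qed

lemma
  assumes G: "pair_graph G" and ne: "pverts G \<noteq> {}"
  shows graph_rho_eigenvector: "\<exists>x. (\<exists>v\<in>pverts G. x v \<noteq> 0) \<and>
      (\<forall>v\<in>pverts G. (\<Sum>u\<in>parcs G `` {v}. x u) = graph_rho G * x v)"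
    and eigenvalue_le_graph_rho: "w \<in> pverts G \<Longrightarrow> x w \<noteq> 0 \<Longrightarrow>
      (\<And>v. v \<in> pverts G \<Longrightarrow> (\<Sum>u\<in>parcs G `` {v}. x u) = c * x v) \<Longrightarrow> c \<le> graph_rho G"
proof -
  interpret G: pair_graph G by (rule G)
  let ?vs = "vertex_list G"
  let ?A = "adjacency_matrix ?vs G"
  have "\<exists>vs. distinct vs \<and> set vs = pverts G"
    using finite_distinct_list[OF G.pair_finite_verts] by blast
  then have vs: "distinct ?vs" "set ?vs = pverts G"
    unfolding vertex_list_def by (metis (mono_tags, lifting) someI_ex)+
  have sub: "parcs G \<subseteq> pverts G \<times> pverts G"
    using G.in_arcsD1 G.in_arcsD2 by auto
  note sums = sum_neighbours[OF G.pair_finite_verts sub]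
  note ev = eigenvalue_adjacency_matrix[OF vs, unfolded sums]
  have A: "?A \<in> carrier_mat (length ?vs) (length ?vs)"
    by (simp add: adjacency_matrix_def)
  have "length ?vs > 0"
    using vs(2) ne by auto
  moreover have "(u, v) \<in> parcs G \<longleftrightarrow> (v, u) \<in> parcs G" for u v
    using G.pair_sym_arcs by (auto simp: symmetric_def dest: symD)
  ultimately have "\<exists>l. eigenvalue ?A l"
    using A by (intro symmetric_real_mat_eigenvalue) (auto simp: adjacency_matrix_def)
  then have "spectrum ?A \<noteq> {}"
    by (auto simp: spectrum_def)
  then have "eigenvalue ?A (graph_rho G)"
    using Max_in[OF card_finite_spectrum(1)[OF A]] by (simp add: spectrum_def graph_rho_def)
  then show "\<exists>x. (\<exists>v\<in>pverts G. x v \<noteq> 0) \<and>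
      (\<forall>v\<in>pverts G. (\<Sum>u\<in>parcs G `` {v}. x u) = graph_rho G * x v)"
    unfolding ev .
  assume "w \<in> pverts G" "x w \<noteq> 0"
    "\<And>v. v \<in> pverts G \<Longrightarrow> (\<Sum>u\<in>parcs G `` {v}. x u) = c * x v"
  then have "eigenvalue ?A c"
    unfolding ev by blast
  then show "c \<le> graph_rho G"
    unfolding graph_rho_def using card_finite_spectrum(1)[OF A]
    by (intro Max_ge) (simp_all add: spectrum_def)
qed

lemma connected_imp_rtrancl:
  assumes G: "pair_graph G" and conn: "Digraph_Component.connected (with_proj G)"
    and uv: "u \<in> pverts G" "v \<in> pverts G"
  shows "(u, v) \<in> (parcs G)\<^sup>*"
proof -
  interpret G: pair_graph G by (rule G)
  have "(u, v) \<in> rtrancl_on (pverts G) (parcs (mk_symmetric (with_proj G)))"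
    using conn uv
    by (auto simp: connected_def strongly_connected_def reachable_def mk_symmetric_def)
  moreover have "(b, a) \<in> parcs G" if "(a, b) \<in> parcs G" for a b
    using G.pair_sym_arcs that by (auto simp: symmetric_def dest: symD)
  then have "parcs (mk_symmetric (with_proj G)) = parcs G"
    by (auto simp: mk_symmetric_def)
  ultimately show ?thesis
    using rtrancl_on_rtranclI by metis
qed

lemma graph_rho_le_supersolution:
  fixes y :: "'a \<Rightarrow> real"
  assumes G: "pair_graph G" and ne: "pverts G \<noteq> {}"
    and pos: "\<And>v. v \<in> pverts G \<Longrightarrow> 0 < y v"
    and super: "\<And>v. v \<in> pverts G \<Longrightarrow> (\<Sum>u\<in>parcs G `` {v}. y u) \<le> c * y v"
  shows "graph_rho G \<le> c"
    and "graph_rho G = c \<Longrightarrow> Digraph_Component.connected (with_proj G) \<Longrightarrow> v \<in> pverts G \<Longrightarrow>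
      (\<Sum>u\<in>parcs G `` {v}. y u) = c * y v"
proof -
  interpret G: pair_graph G by (rule G)
  have sub: "parcs G \<subseteq> pverts G \<times> pverts G"
    using G.in_arcsD1 G.in_arcsD2 by auto
  obtain x w where x: "w \<in> pverts G" "x w \<noteq> 0"
    and eig: "\<And>v. v \<in> pverts G \<Longrightarrow> (\<Sum>u\<in>parcs G `` {v}. x u) = graph_rho G * x v"
    using graph_rho_eigenvector[OF G ne] by blast
  note bound = eigenvalue_le_supersolution[OF G.pair_finite_verts sub pos super eig x]
  show "graph_rho G \<le> c"
    by (rule bound(1))
  assume "graph_rho G = c" and conn: "Digraph_Component.connected (with_proj G)"
    and v: "v \<in> pverts G"
  moreover have "(u, v) \<in> (parcs G)\<^sup>*" if "u \<in> pverts G" "v \<in> pverts G" for u v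
    using connected_imp_rtrancl[OF G conn that] .
  ultimately show "(\<Sum>u\<in>parcs G `` {v}. y u) = c * y v"
    using bound(2) by blast
qed

section \<open>Two cliques joined by few edges\<close>

lemma sum_clique_le:
  fixes y :: "'a \<Rightarrow> real"
  assumes "finite U" "u \<in> U" "N \<subseteq> U - {u}" "\<And>w. w \<in> U \<Longrightarrow> 0 < y w"
  shows "sum y N \<le> sum y U - y u"
    and "sum y N = sum y U - y u \<Longrightarrow> N = U - {u}"
proof -
  have U: "sum y U - y u = sum y (U - {u})"
    using assms by (simp add: sum_diff1)
  show "sum y N \<le> sum y U - y u"
    unfolding U by (rule sum_mono2) (use assms in \<open>auto simp: less_imp_le\<close>)
  assume eq: "sum y N = sum y U - y u"
  show "N = U - {u}"
  proof (rule ccontr)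
    assume "N \<noteq> U - {u}"
    then obtain w where w: "w \<in> U - {u} - N"
      using assms(3) by blast
    have "sum y N < sum y (U - {u})"
      by (rule sum_strict_mono2[of _ _ w]) (use assms w in \<open>auto simp: less_imp_le\<close>)
    then show False
      using eq U by simp
  qed
qed

locale bipartitioned_graph =
  fixes V\<^sub>1 V\<^sub>2 :: "'a set" and A :: "'a rel"
  assumes fin: "finite V\<^sub>1" "finite V\<^sub>2" and disj: "V\<^sub>1 \<inter> V\<^sub>2 = {}"
    and arcs: "A \<subseteq> (V\<^sub>1 \<union> V\<^sub>2) \<times> (V\<^sub>1 \<union> V\<^sub>2)"
    and sym: "(u, v) \<in> A \<Longrightarrow> (v, u) \<in> A" and irrefl: "(u, u) \<notin> A"
begin

definition cross :: "'a \<Rightarrow> 'a set" where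
  "cross v = A `` {v} \<inter> (if v \<in> V\<^sub>1 then V\<^sub>2 else V\<^sub>1)"

definition cdeg :: "'a \<Rightarrow> real" where
  "cdeg v = real (card (cross v))"

lemma finite_cross [simp]: "finite (cross v)"
  using fin by (simp add: cross_def)

lemma cdeg_nonneg [simp]: "0 \<le> cdeg v"
  by (simp add: cdeg_def)

lemma cross1: "u \<in> V\<^sub>1 \<Longrightarrow> cross u = A `` {u} \<inter> V\<^sub>2"
  and cross2: "v \<in> V\<^sub>2 \<Longrightarrow> cross v = A `` {v} \<inter> V\<^sub>1"
  using disj by (auto simp: cross_def)

lemma cross_sym: "u \<in> V\<^sub>1 \<Longrightarrow> v \<in> V\<^sub>2 \<Longrightarrow> u \<in> cross v \<longleftrightarrow> v \<in> cross u"
  using sym by (auto simp: cross1 cross2)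

lemma cdeg_ge_1: "w \<in> cross v \<Longrightarrow> 1 \<le> cdeg v"
proof -
  assume "w \<in> cross v"
  then have "0 < card (cross v)"
    by (auto simp: card_gt_0_iff)
  then show ?thesis by (simp add: cdeg_def)
qed

lemma flip: "bipartitioned_graph V\<^sub>2 V\<^sub>1 A"
  using fin disj arcs sym irrefl by unfold_locales auto

lemma cross_flip: "v \<in> V\<^sub>1 \<union> V\<^sub>2 \<Longrightarrow> bipartitioned_graph.cross V\<^sub>2 V\<^sub>1 A v = cross v"
  using disj by (auto simp: cross_def bipartitioned_graph.cross_def[OF flip])

lemma cdeg_flip: "v \<in> V\<^sub>1 \<union> V\<^sub>2 \<Longrightarrow> bipartitioned_graph.cdeg V\<^sub>2 V\<^sub>1 A v = cdeg v"
  by (simp add: cdeg_def bipartitioned_graph.cdeg_def[OF flip] cross_flip)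

lemma sum_cross_swap:
  fixes h :: "'a \<Rightarrow> real"
  shows "(\<Sum>v\<in>V\<^sub>2. \<Sum>u\<in>cross v. h u) = (\<Sum>u\<in>V\<^sub>1. cdeg u * h u)"
proof -
  have "(\<Sum>v\<in>V\<^sub>2. \<Sum>u\<in>cross v. h u) = (\<Sum>v\<in>V\<^sub>2. \<Sum>u\<in>{u\<in>V\<^sub>1. (v, u) \<in> A}. h u)"
    by (intro sum.cong refl) (auto simp: cross2)
  also have "\<dots> = (\<Sum>u\<in>V\<^sub>1. \<Sum>v\<in>{v\<in>V\<^sub>2. (v, u) \<in> A}. h u)"
    by (rule sum.swap_restrict) (use fin in auto)
  also have "\<dots> = (\<Sum>u\<in>V\<^sub>1. cdeg u * h u)"
  proof (rule sum.cong)
    fix u assume "u \<in> V\<^sub>1"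
    then have "{v\<in>V\<^sub>2. (v, u) \<in> A} = cross u"
      using sym by (auto simp: cross1)
    then show "(\<Sum>v\<in>{v\<in>V\<^sub>2. (v, u) \<in> A}. h u) = cdeg u * h u"
      by (simp add: cdeg_def)
  qed simp
  finally show ?thesis .
qed

lemma sum_cdeg_eq: "(\<Sum>v\<in>V\<^sub>2. cdeg v) = (\<Sum>u\<in>V\<^sub>1. cdeg u)"
  using sum_cross_swap[of "\<lambda>_. 1"] by (simp add: cdeg_def)

lemma sum_cdeg_card: "(\<Sum>u\<in>V\<^sub>1. cdeg u) = real (card (A \<inter> V\<^sub>1 \<times> V\<^sub>2))"
proof -
  have "A \<inter> V\<^sub>1 \<times> V\<^sub>2 = Sigma V\<^sub>1 cross"
    by (auto simp: cross1)
  then show ?thesis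
    using fin by (simp add: cdeg_def)
qed

lemma sum_arcs_split:
  assumes "u \<in> V\<^sub>1"
  shows "(\<Sum>w\<in>A `` {u}. y w) = (\<Sum>w\<in>A `` {u} \<inter> V\<^sub>1. y w) + (\<Sum>w\<in>cross u. y w :: real)"
proof -
  have "A `` {u} = (A `` {u} \<inter> V\<^sub>1) \<union> cross u"
    using arcs assms by (auto simp: cross1)
  moreover have "(A `` {u} \<inter> V\<^sub>1) \<inter> cross u = {}"
    using disj assms by (auto simp: cross1)
  ultimately show ?thesis
    using fin by (metis finite_Int finite_cross sum.union_disjoint)
qed

lemma inside_subset: "A `` {u} \<inter> V\<^sub>1 \<subseteq> V\<^sub>1 - {u}"
  using irrefl by auto

text \<open>
  With the weight \<open>1 + cdeg v / E\<close> both cliques have total weight at most \<open>c + 1\<close>, and the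
  neighbours across contribute at most \<open>cdeg v + 1\<close>, which the excess weight of \<open>v\<close> pays for.
\<close>

lemma spread_supersolution:
  assumes u: "u \<in> V\<^sub>1" and E: "E = (\<Sum>u\<in>V\<^sub>1. cdeg u)" "1 \<le> E"
    and c: "real (card V\<^sub>1) \<le> c" "2 * E \<le> c + 1"
  shows "(\<Sum>w\<in>A `` {u}. 1 + cdeg w / E) \<le> c * (1 + cdeg u / E)"
proof -
  let ?y = "\<lambda>w. 1 + cdeg w / E"
  have pos: "0 < ?y w" for w
    using E(2) by (simp add: add_pos_nonneg)
  have V1: "sum ?y V\<^sub>1 = real (card V\<^sub>1) + 1"
    using E by (simp add: sum.distrib sum_divide_distrib[symmetric])
  have in1: "(\<Sum>w\<in>A `` {u} \<inter> V\<^sub>1. ?y w) \<le> sum ?y V\<^sub>1 - ?y u"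
    by (rule sum_clique_le(1)[OF fin(1) u inside_subset]) (rule pos)
  have out: "(\<Sum>w\<in>cross u. ?y w) \<le> (c + 1) * (cdeg u / E)"
  proof (cases "cross u = {}")
    case True
    then show ?thesis using E(2) c by (simp add: cdeg_def)
  next
    case False
    then have d: "1 \<le> cdeg u" using cdeg_ge_1 by blast
    have "(\<Sum>w\<in>cross u. cdeg w) \<le> (\<Sum>w\<in>V\<^sub>2. cdeg w)"
      using fin u by (intro sum_mono2) (auto simp: cross1)
    then have "(\<Sum>w\<in>cross u. cdeg w) / E \<le> 1"
      using E by (simp add: sum_cdeg_eq)
    then have "(\<Sum>w\<in>cross u. ?y w) \<le> cdeg u + 1"
      by (simp add: sum.distrib sum_divide_distrib[symmetric] cdeg_def)
    also have "\<dots> \<le> 2 * cdeg u" using d by simp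
    also have "\<dots> \<le> (c + 1) / E * cdeg u"
      using c(2) E(2) d by (intro mult_right_mono) (auto simp: pos_le_divide_eq)
    finally show ?thesis by simp
  qed
  have "(\<Sum>w\<in>A `` {u}. ?y w) \<le> c + 1 - ?y u + (c + 1) * (cdeg u / E)"
    using sum_arcs_split[OF u, of ?y] in1 out V1 c(1) by linarith
  also have "\<dots> = c * ?y u" by (simp add: algebra_simps add_divide_distrib)
  finally show ?thesis .
qed

end

text \<open>
  The difference of the two sides is a sum of four nonnegative terms.  In the
  application \<open>g\<close> is the number of neighbours across of a vertex \<open>v\<close> in the larger clique, \<open>T\<close> is the
  sum and \<open>S\<close> the sum of squares of the numbers of edges across, over the neighbours of \<open>v\<close> and over
  the smaller clique respectively.  The price \<open>\<alpha> \<epsilon> (g - 1)\<close> of a second neighbour is less than what is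
  gained in \<open>S\<close>, because \<open>\<alpha> \<epsilon> < E\<close>.
\<close>

lemma excess_bound:
  fixes \<alpha> \<epsilon> E E' g S T :: real
  assumes "0 < \<alpha>" "0 < \<epsilon>" "\<alpha> * \<epsilon> < E" "1 \<le> g" "g \<le> E'" "E' \<le> E" "T \<le> E'"
    and S: "S \<le> E' * (E' - (g - 1))"
  shows "\<alpha> * E' + S + \<epsilon> * (\<alpha> * g + T) \<le> (\<alpha> + E) * (E + \<epsilon>)"
    and "\<alpha> * E' + S + \<epsilon> * (\<alpha> * g + T) = (\<alpha> + E) * (E + \<epsilon>) \<Longrightarrow> g = 1 \<and> T = E"
proof -
  have split: "(\<alpha> + E) * (E + \<epsilon>) - (\<alpha> * E' + S + \<epsilon> * (\<alpha> * g + T)) =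
      (E - E') * (\<alpha> + \<epsilon> + E + E' - (g - 1)) + (E - \<alpha> * \<epsilon>) * (g - 1) + \<epsilon> * (E' - T)
      + (E' * (E' - (g - 1)) - S)"
    by (simp add: algebra_simps)
  have nonneg: "0 \<le> (E - E') * (\<alpha> + \<epsilon> + E + E' - (g - 1))" "0 \<le> (E - \<alpha> * \<epsilon>) * (g - 1)"
    "0 \<le> \<epsilon> * (E' - T)"
    using assms by (intro mult_nonneg_nonneg; simp)+
  with S show "\<alpha> * E' + S + \<epsilon> * (\<alpha> * g + T) \<le> (\<alpha> + E) * (E + \<epsilon>)"
    using split by linarith
  assume "\<alpha> * E' + S + \<epsilon> * (\<alpha> * g + T) = (\<alpha> + E) * (E + \<epsilon>)"
  then have "(E - E') * (\<alpha> + \<epsilon> + E + E' - (g - 1)) = 0" "(E - \<alpha> * \<epsilon>) * (g - 1) = 0"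
    "\<epsilon> * (E' - T) = 0"
    using S split nonneg by linarith+
  then show "g = 1 \<and> T = E"
    using assms by auto
qed

text \<open>
  Here \<open>r - 1\<close> is the spectral radius of two cliques, of the orders of \<open>V\<^sub>1\<close> and \<open>V\<^sub>2\<close>, joined by the
  \<open>E\<close> edges of a star with centre in the smaller clique.  The eigenvector of that graph, normalised
  to be \<open>r\<close> at the leaves of the star, is \<open>\<alpha> + E\<close> at the centre and \<open>\<alpha>\<close> in the rest of the smaller
  clique.  Eliminating its value in the rest of the larger clique leaves the equations \<open>root\<close>.
\<close>

locale star_comparison = bipartitioned_graph V\<^sub>1 V\<^sub>2 A for V\<^sub>1 V\<^sub>2 :: "'a set" and A +
  fixes r \<alpha> E :: real
  assumes order: "card V\<^sub>1 < card V\<^sub>2" "real (card V\<^sub>2) < r"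
    and root: "0 < \<alpha>" "\<alpha> * (r - real (card V\<^sub>1)) = E"
      "r\<^sup>2 * (r - real (card V\<^sub>2)) = (\<alpha> + E) * (E + (r - real (card V\<^sub>2)))"
    and edges: "1 \<le> (\<Sum>u\<in>V\<^sub>1. cdeg u)" "(\<Sum>u\<in>V\<^sub>1. cdeg u) \<le> E"
begin

abbreviation "E' \<equiv> \<Sum>u\<in>V\<^sub>1. cdeg u"
abbreviation "S \<equiv> \<Sum>u\<in>V\<^sub>1. cdeg u * cdeg u"
abbreviation "T v \<equiv> \<Sum>u\<in>cross v. cdeg u"
abbreviation "\<epsilon> \<equiv> r - real (card V\<^sub>2)"

text \<open>
  In the smaller clique the weight is an affine function of the number of edges across.  In the
  larger clique it is chosen such that, if this is indeed a clique, the eigenvalue equation for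
  \<open>r - 1\<close> holds exactly at each of its vertices.  For the star this is the eigenvector.
\<close>

definition base :: real where
  "base = (\<alpha> * E' + S) / (r * \<epsilon>)"

definition weight :: "'a \<Rightarrow> real" where
  "weight w = (if w \<in> V\<^sub>1 then \<alpha> + cdeg w else base + (\<alpha> * cdeg w + T w) / r)"

lemma r_pos: "0 < r" and eps_pos: "0 < \<epsilon>"
  using order(2) by auto

lemma weight1: "u \<in> V\<^sub>1 \<Longrightarrow> weight u = \<alpha> + cdeg u"
  by (simp add: weight_def)

lemma weight2: "v \<in> V\<^sub>2 \<Longrightarrow> weight v = base + (\<alpha> * cdeg v + T v) / r"
  using disj by (auto simp: weight_def)

lemma base_pos: "0 < base"
proof -
  have "0 < \<alpha> * E'" "0 \<le> S"
    using root(1) edges(1) by (auto intro: sum_nonneg)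
  then show ?thesis
    unfolding base_def using r_pos eps_pos by (intro divide_pos_pos) auto
qed

lemma weight_pos: "0 < weight w"
  using base_pos root(1) r_pos unfolding weight_def
  by (auto intro!: add_pos_nonneg divide_nonneg_pos add_nonneg_nonneg sum_nonneg mult_nonneg_nonneg)

lemma sum_weight1: "sum weight V\<^sub>1 = real (card V\<^sub>1) * \<alpha> + E'"
proof -
  have "sum weight V\<^sub>1 = (\<Sum>u\<in>V\<^sub>1. \<alpha> + cdeg u)"
    by (rule sum.cong) (simp_all add: weight1)
  then show ?thesis by (simp add: sum.distrib)
qed

lemma sum_weight2: "sum weight V\<^sub>2 = r * base"
proof -
  have "sum weight V\<^sub>2 = (\<Sum>v\<in>V\<^sub>2. base + (\<alpha> * cdeg v + T v) / r)"
    by (rule sum.cong) (simp_all add: weight2)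
  also have "\<dots> = real (card V\<^sub>2) * base + (\<alpha> * E' + S) / r"
    by (simp add: sum.distrib sum_divide_distrib[symmetric] sum_distrib_left[symmetric]
        sum_cdeg_eq sum_cross_swap)
  also have "(\<alpha> * E' + S) / r = \<epsilon> * base"
    unfolding base_def using r_pos eps_pos by (simp add: field_simps)
  finally show ?thesis by (simp add: algebra_simps)
qed

text \<open>
  The value \<open>r\<close> is the weight of a leaf of the star.  If \<open>v\<close> has \<open>g\<close> neighbours across, then for
  each vertex \<open>w\<close> of the smaller clique at least \<open>g - 1\<close> edges across end at neighbours of \<open>v\<close> other
  than \<open>w\<close>.  This bounds \<open>cdeg w\<close> and with it the sum of squares in \<open>base\<close>.
\<close>

lemma weight_cross:
  assumes v: "v \<in> V\<^sub>2" and u: "u \<in> cross v"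
  shows "weight v \<le> r" and "weight v = r \<Longrightarrow> cdeg v = 1 \<and> T v = E"
proof -
  have N: "cross v \<subseteq> V\<^sub>1"
    using v by (auto simp: cross2)
  have deg: "1 \<le> cdeg w" if "w \<in> cross v" for w
    using that N v cross_sym[of w v] cdeg_ge_1 by blast
  have card: "real (card M) \<le> sum cdeg M" if "M \<subseteq> cross v" for M
    using sum_mono[of M "\<lambda>_. 1" cdeg] deg that by (simp add: subset_iff)
  have sub: "sum cdeg M \<le> sum cdeg M'" if "M \<subseteq> M'" "M' \<subseteq> V\<^sub>1" for M M'
    using that fin(1) finite_subset by (intro sum_mono2) auto
  have T: "T v \<le> E'"
    using sub[OF N] by simp
  have g: "1 \<le> cdeg v" "cdeg v \<le> E'"
    using cdeg_ge_1[OF u] card[of "cross v"] T by (simp_all add: cdeg_def)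
  have S: "S \<le> E' * (E' - (cdeg v - 1))"
  proof -
    have "cdeg w \<le> E' - (cdeg v - 1)" if w: "w \<in> V\<^sub>1" for w
    proof -
      have "cdeg v - 1 \<le> real (card (cross v - {w}))"
        unfolding cdeg_def by (cases "w \<in> cross v") auto
      also have "\<dots> \<le> sum cdeg (cross v - {w})"
        by (rule card) auto
      also have "\<dots> \<le> sum cdeg (V\<^sub>1 - {w})"
        by (rule sub) (use N in auto)
      also have "\<dots> = E' - cdeg w"
        using fin w by (simp add: sum_diff1)
      finally show ?thesis by simp
    qed
    then have "S \<le> (\<Sum>w\<in>V\<^sub>1. cdeg w * (E' - (cdeg v - 1)))"
      by (intro sum_mono mult_left_mono) auto
    then show ?thesis by (simp add: sum_distrib_right)
  qed
  have "\<alpha> * \<epsilon> < \<alpha> * (r - real (card V\<^sub>1))"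
    using order root(1) by (intro mult_strict_left_mono) auto
  then have aE: "\<alpha> * \<epsilon> < E"
    using root(2) by simp
  note bound = excess_bound[OF root(1) eps_pos aE g edges(2) T S]
  have eq: "\<alpha> * E' + S + \<epsilon> * (\<alpha> * cdeg v + T v) = r * \<epsilon> * weight v"
    unfolding weight2[OF v] base_def using r_pos eps_pos by (simp add: field_simps)
  have root': "(\<alpha> + E) * (E + \<epsilon>) = r * \<epsilon> * r"
    using root(3) by (simp add: power2_eq_square mult_ac)
  have re: "0 < r * \<epsilon>"
    using r_pos eps_pos by simp
  show "weight v \<le> r"
    using bound(1) re unfolding eq root' by (simp only: mult_le_cancel_left_pos)
  show "cdeg v = 1 \<and> T v = E" if "weight v = r"
    by (rule bound(2)) (simp add: eq root' that)
qed

text \<open>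
  The edges across increase the left-hand side by at most \<open>r\<close> each, and exactly this is what they add
  to \<open>r\<close> times the weight of their end in the smaller clique.
\<close>

lemma slack1:
  assumes u: "u \<in> V\<^sub>1"
  shows "(\<Sum>w\<in>A `` {u}. weight w) \<le> (r - 1) * weight u"
    and "(\<Sum>w\<in>A `` {u}. weight w) = (r - 1) * weight u \<Longrightarrow>
      A `` {u} \<inter> V\<^sub>1 = V\<^sub>1 - {u} \<and> E' = E \<and> (\<forall>v\<in>cross u. weight v = r)"
proof -
  have in1: "(\<Sum>w\<in>A `` {u} \<inter> V\<^sub>1. weight w) \<le> sum weight V\<^sub>1 - weight u"
    by (rule sum_clique_le(1)[OF fin(1) u inside_subset]) (rule weight_pos)
  have le_r: "weight v \<le> r" if "v \<in> cross u" for v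
    using that u cross_sym[of u v] by (intro weight_cross(1)[of v u]) (auto simp: cross1)
  then have out: "(\<Sum>w\<in>cross u. weight w) \<le> r * cdeg u"
    using sum_bounded_above[of "cross u" weight r] by (simp add: cdeg_def mult.commute)
  have total: "r * \<alpha> - weight u + r * cdeg u = (r - 1) * weight u"
    by (simp add: weight1[OF u] algebra_simps)
  have "sum weight V\<^sub>1 = r * \<alpha> - (E - E')"
    unfolding sum_weight1 root(2)[symmetric] by (simp add: algebra_simps)
  then have V1: "sum weight V\<^sub>1 \<le> r * \<alpha>" "sum weight V\<^sub>1 = r * \<alpha> \<Longrightarrow> E' = E"
    using edges(2) by simp_all
  note split = sum_arcs_split[OF u, of weight]
  show "(\<Sum>w\<in>A `` {u}. weight w) \<le> (r - 1) * weight u"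
    using split in1 out V1(1) total by linarith
  assume "(\<Sum>w\<in>A `` {u}. weight w) = (r - 1) * weight u"
  then have eqs: "(\<Sum>w\<in>A `` {u} \<inter> V\<^sub>1. weight w) = sum weight V\<^sub>1 - weight u"
    "(\<Sum>w\<in>cross u. weight w) = r * cdeg u" "sum weight V\<^sub>1 = r * \<alpha>"
    using split in1 out V1(1) total by linarith+
  have "weight v = r" if v: "v \<in> cross u" for v
  proof (rule ccontr)
    assume "weight v \<noteq> r"
    then have "weight v < r" using le_r[OF v] by simp
    then have "(\<Sum>w\<in>cross u. weight w) < (\<Sum>w\<in>cross u. r)"
      using le_r v by (intro sum_strict_mono_ex1) auto
    then show False using eqs(2) by (simp add: cdeg_def mult.commute)
  qed
  moreover have "A `` {u} \<inter> V\<^sub>1 = V\<^sub>1 - {u}"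
    by (rule sum_clique_le(2)[OF fin(1) u inside_subset weight_pos eqs(1)])
  ultimately show "A `` {u} \<inter> V\<^sub>1 = V\<^sub>1 - {u} \<and> E' = E \<and> (\<forall>v\<in>cross u. weight v = r)"
    using V1(2)[OF eqs(3)] by blast
qed

lemma slack2:
  assumes v: "v \<in> V\<^sub>2"
  shows "(\<Sum>w\<in>A `` {v}. weight w) \<le> (r - 1) * weight v"
    and "(\<Sum>w\<in>A `` {v}. weight w) = (r - 1) * weight v \<Longrightarrow> A `` {v} \<inter> V\<^sub>2 = V\<^sub>2 - {v}"
proof -
  interpret F: bipartitioned_graph V\<^sub>2 V\<^sub>1 A by (rule flip)
  have "F.cross v = cross v"
    using v by (intro cross_flip) simp
  then have split: "(\<Sum>w\<in>A `` {v}. weight w)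
      = (\<Sum>w\<in>A `` {v} \<inter> V\<^sub>2. weight w) + (\<Sum>w\<in>cross v. weight w)"
    using F.sum_arcs_split[OF v, of weight] by simp
  have "(\<Sum>w\<in>cross v. weight w) = (\<Sum>w\<in>cross v. \<alpha> + cdeg w)"
    using v by (intro sum.cong refl) (auto simp: cross2 weight1)
  also have "\<dots> = \<alpha> * cdeg v + T v"
    by (simp add: sum.distrib cdeg_def)
  also have "\<dots> = r * weight v - r * base"
    unfolding weight2[OF v] using r_pos by (simp add: field_simps)
  finally have total: "sum weight V\<^sub>2 - weight v + (\<Sum>w\<in>cross v. weight w) = (r - 1) * weight v"
    by (simp add: sum_weight2 algebra_simps)
  note clique = sum_clique_le[where y = weight, OF fin(2) v F.inside_subset weight_pos]
  show "(\<Sum>w\<in>A `` {v}. weight w) \<le> (r - 1) * weight v"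
    using split total clique(1) by linarith
  show "A `` {v} \<inter> V\<^sub>2 = V\<^sub>2 - {v}" if "(\<Sum>w\<in>A `` {v}. weight w) = (r - 1) * weight v"
    by (rule clique(2)) (use that split total in linarith)
qed

text \<open>
  Without slack a vertex \<open>v\<close> at the end of an edge across has weight \<open>r\<close>, so it has a single
  neighbour across and all \<open>E\<close> edges start there.
\<close>

lemma star_if_no_slack:
  assumes eq: "\<And>w. w \<in> V\<^sub>1 \<union> V\<^sub>2 \<Longrightarrow> (\<Sum>w'\<in>A `` {w}. weight w') = (r - 1) * weight w"
  shows "\<exists>c\<in>V\<^sub>1. \<exists>W\<subseteq>V\<^sub>2. real (card W) = E \<and>
    A = {(u, v). u \<in> V\<^sub>1 \<and> v \<in> V\<^sub>1 \<and> u \<noteq> v} \<union> {(u, v). u \<in> V\<^sub>2 \<and> v \<in> V\<^sub>2 \<and> u \<noteq> v}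
      \<union> {c} \<times> W \<union> W \<times> {c}"
proof -
  obtain c where c: "c \<in> V\<^sub>1" "cdeg c \<noteq> 0"
    using edges(1) by (metis not_one_le_zero sum.neutral)
  then obtain v where v: "v \<in> cross c"
    by (auto simp: cdeg_def)
  have v2: "v \<in> V\<^sub>2" "c \<in> cross v"
    using v c cross_sym[of c v] by (auto simp: cross1)
  have EE: "E' = E" and "weight v = r"
    using slack1(2)[OF c(1) eq] c v by auto
  then have "cdeg v = 1" "T v = E"
    using weight_cross(2)[OF v2] by auto
  moreover from this have "cross v = {c}"
    using v2(2) by (auto simp: cdeg_def card_1_singleton_iff)
  ultimately have dc: "cdeg c = E"
    by simp
  have "(\<Sum>u\<in>V\<^sub>1 - {c}. cdeg u) = 0"
    using fin c EE dc by (simp add: sum_diff1)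
  then have "cdeg u = 0" if "u \<in> V\<^sub>1 - {c}" for u
    using that fin by (subst (asm) sum_nonneg_eq_0_iff) auto
  then have none: "cross u = {}" if "u \<in> V\<^sub>1 - {c}" for u
    using that by (simp add: cdeg_def)
  have in1: "(u, w) \<in> A \<longleftrightarrow> u \<noteq> w" if "u \<in> V\<^sub>1" "w \<in> V\<^sub>1" for u w
    using slack1(2)[OF that(1) eq] that by auto
  have in2: "(u, w) \<in> A \<longleftrightarrow> u \<noteq> w" if "u \<in> V\<^sub>2" "w \<in> V\<^sub>2" for u w
    using slack2(2)[OF that(1) eq] that by auto
  have out: "(u, w) \<in> A \<longleftrightarrow> u = c \<and> w \<in> cross c" if "u \<in> V\<^sub>1" "w \<in> V\<^sub>2" for u w
    using none[of u] that by (cases "u = c") (auto simp: cross1)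
  define B where "B = {(u, v). u \<in> V\<^sub>1 \<and> v \<in> V\<^sub>1 \<and> u \<noteq> v} \<union> {(u, v). u \<in> V\<^sub>2 \<and> v \<in> V\<^sub>2 \<and> u \<noteq> v}
      \<union> {c} \<times> cross c \<union> cross c \<times> {c}"
  have W: "cross c \<subseteq> V\<^sub>2"
    using c by (auto simp: cross1)
  have "(u, w) \<in> A \<longleftrightarrow> (u, w) \<in> B" if "u \<in> V\<^sub>1 \<union> V\<^sub>2" "w \<in> V\<^sub>1 \<union> V\<^sub>2" for u w
  proof -
    have not2: "x \<notin> V\<^sub>2" if "x \<in> V\<^sub>1" for x
      using that disj by blast
    consider "u \<in> V\<^sub>1" "w \<in> V\<^sub>1" | "u \<in> V\<^sub>1" "w \<in> V\<^sub>2" | "u \<in> V\<^sub>2" "w \<in> V\<^sub>1" | "u \<in> V\<^sub>2" "w \<in> V\<^sub>2"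
      using \<open>u \<in> V\<^sub>1 \<union> V\<^sub>2\<close> \<open>w \<in> V\<^sub>1 \<union> V\<^sub>2\<close> by blast
    then show ?thesis
    proof cases
      case 1
      then show ?thesis using in1 not2[OF 1(1)] not2[OF 1(2)] W by (auto simp: B_def)
    next
      case 2
      then have "w \<notin> V\<^sub>1" using not2 by blast
      then show ?thesis using 2 out not2[OF 2(1)] not2[OF c(1)] W by (auto simp: B_def)
    next
      case 3
      then have "(u, w) \<in> A \<longleftrightarrow> w = c \<and> u \<in> cross c"
        using out[of w u] sym by blast
      moreover have "u \<notin> V\<^sub>1" using 3 not2 by blast
      ultimately show ?thesis using 3 not2[OF 3(2)] not2[OF c(1)] W by (auto simp: B_def)
    next
      case 4
      then show ?thesis using in2 not2[OF c(1)] not2[of u] not2[of w] by (auto simp: B_def)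
    qed
  qed
  moreover have "B \<subseteq> (V\<^sub>1 \<union> V\<^sub>2) \<times> (V\<^sub>1 \<union> V\<^sub>2)"
    using W c by (auto simp: B_def)
  ultimately have "A = B"
    using arcs by blast
  then show ?thesis
    using c(1) W dc unfolding B_def cdeg_def by blast
qed

end

text \<open>
  After elimination of \<open>\<alpha>\<close> the two sides of the last equation are polynomials in \<open>r\<close>: at \<open>r = b\<close> the left
  one vanishes and the right one is positive, while at \<open>r = b + E\<close> the left one has caught up.
\<close>

lemma star_root_exists:
  fixes s b E :: real
  assumes "1 \<le> s" "s + 1 \<le> b" "1 \<le> E"
  shows "\<exists>r \<alpha>. b < r \<and> 0 < \<alpha> \<and> \<alpha> * (r - s) = E \<and> r\<^sup>2 * (r - b) = (\<alpha> + E) * (E + (r - b))"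
proof -
  \<comment> \<open>the equation with \<open>\<alpha> = E / (r - s)\<close> inserted and multiplied by \<open>r - s\<close>\<close>
  define h where "h r = r\<^sup>2 * (r - b) * (r - s) - E * (r - s + 1) * (E + (r - b))" for r
  have hb: "h b < 0"
    unfolding h_def using assms by simp
  have "0 \<le> h (b + E)"
  proof -
    have "2 * E\<^sup>2 * (b + E - s + 1) \<le> (b + E)\<^sup>2 * E * (b + E - s)"
    proof -
      have a: "2 * E * (b + E - s + 1) \<le> (b + E)\<^sup>2 * (b + E - s)"
      proof -
        have "2 * E * (b + E - s + 1) \<le> 2 * E * (2 * (b + E - s))"
          using assms by (intro mult_left_mono) auto
        also have "\<dots> = 4 * E * (b + E - s)" by simp
        also have "\<dots> \<le> (b + E)\<^sup>2 * (b + E - s)"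
        proof (rule mult_right_mono)
          have "(b + E)\<^sup>2 - 4 * E * b = (b - E)\<^sup>2"
            by (simp add: power2_eq_square algebra_simps)
          then have "4 * E * b \<le> (b + E)\<^sup>2"
            by (smt (verit) zero_le_power2)
          moreover have "4 * E * 1 \<le> 4 * E * b"
            using assms by (intro mult_left_mono) auto
          ultimately show "4 * E \<le> (b + E)\<^sup>2" by simp
        qed (use assms in auto)
        finally show ?thesis .
      qed
      have "E * (2 * E * (b + E - s + 1)) \<le> E * ((b + E)\<^sup>2 * (b + E - s))"
        using a assms by (intro mult_left_mono) auto
      then show ?thesis by (simp add: power2_eq_square mult_ac)
    qed
    then show ?thesis
      by (simp add: h_def power2_eq_square algebra_simps)
  qed
  moreover have "continuous_on {b..b + E} h"
    unfolding h_def by (intro continuous_intros)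
  ultimately obtain r where r: "b \<le> r" "r \<le> b + E" "h r = 0"
    using IVT'[of h b 0 "b + E"] hb assms by auto
  then have br: "b < r"
    using hb by (cases "r = b") auto
  have rs: "0 < r - s" using br assms by simp
  define \<alpha> where "\<alpha> = E / (r - s)"
  have \<alpha>: "0 < \<alpha>" "\<alpha> * (r - s) = E"
    unfolding \<alpha>_def using rs assms by simp_all
  have "(r\<^sup>2 * (r - b)) * (r - s) = E * (r - s + 1) * (E + (r - b))"
    using r(3) unfolding h_def by simp
  also have "E * (r - s + 1) = (\<alpha> + E) * (r - s)"
    using \<alpha>(2) by (simp add: algebra_simps)
  finally have "r\<^sup>2 * (r - b) = (\<alpha> + E) * (E + (r - b))"
    using rs by simp
  then show ?thesis
    using br \<alpha> by blast
qed

text \<open>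
  The eigenvector \<open>x\<close> is constant on the centre, the rest of the smaller clique, the leaves and the
  rest of the larger clique; \<open>q\<close> is its value on the last class.
\<close>

lemma B_graph_rho_ge:
  fixes r \<alpha> :: real
  assumes s: "0 < s" and i: "i \<le> n - s" "s < n" and r: "real (n - s) < r"
    and root: "0 < \<alpha>" "\<alpha> * (r - real s) = real i"
      "r\<^sup>2 * (r - real (n - s)) = (\<alpha> + real i) * (real i + (r - real (n - s)))"
  shows "r - 1 \<le> graph_rho (B_graph n s i)"
proof -
  let ?B = "B_graph n s i" and ?\<epsilon> = "r - real (n - s)"
  define q where "q = (\<alpha> * real i + real i * real i) / (r * ?\<epsilon>)"
  define x where "x u = (if u = 0 then \<alpha> + real i else if u < s then \<alpha>
    else if u < s + i then r else q)" for u :: nat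
  have pos: "0 < r" "0 < ?\<epsilon>" using r by auto
  have rqe: "r * q * ?\<epsilon> = \<alpha> * real i + real i * real i"
    unfolding q_def using pos by simp
  have rq: "r * q + (\<alpha> + real i) = r * r"
  proof -
    from rqe have "(r * q + (\<alpha> + real i)) * ?\<epsilon> = (r * r) * ?\<epsilon>"
      using root(3) by (simp add: power2_eq_square algebra_simps)
    then show ?thesis using pos by simp
  qed
  have low: "(\<Sum>u\<in>{..<s}. x u) = r * \<alpha>"
  proof -
    have "(\<Sum>u\<in>{..<s}. x u) = (\<Sum>u\<in>{..<s}. \<alpha> + (if u = 0 then real i else 0))"
      by (intro sum.cong) (auto simp: x_def)
    also have "\<dots> = real s * \<alpha> + real i"
      using s by (simp add: sum.distrib)
    finally show ?thesis using root(2) by (simp add: algebra_simps)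
  qed
  have mid: "(\<Sum>u\<in>{s..<s + i}. x u) = real i * r"
    using s by (simp add: x_def)
  have high: "(\<Sum>u\<in>{s..<n}. x u) = r * q"
  proof -
    have "{s..<n} = {s..<s + i} \<union> {s + i..<n}" "{s..<s + i} \<inter> {s + i..<n} = {}"
      using i by auto
    then have "(\<Sum>u\<in>{s..<n}. x u) = (\<Sum>u\<in>{s..<s + i}. x u) + (\<Sum>u\<in>{s + i..<n}. x u)"
      by (metis finite_atLeastLessThan sum.union_disjoint)
    also have "(\<Sum>u\<in>{s + i..<n}. x u) = real (n - (s + i)) * q"
      using s by (simp add: x_def)
    also have "real (n - (s + i)) = real (n - s) - real i"
      using i by linarith
    finally have sum: "(\<Sum>u\<in>{s..<n}. x u) = real i * (r - q) + real (n - s) * q"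
      unfolding mid by (simp add: algebra_simps)
    have "r * (real i * (r - q)) = real i * (r * r - r * q)"
      by (simp add: algebra_simps)
    also have "r * r - r * q = \<alpha> + real i"
      using rq by simp
    also have "real i * (\<alpha> + real i) = r * (?\<epsilon> * q)"
      using rqe by (simp add: algebra_simps)
    finally have "real i * (r - q) = ?\<epsilon> * q"
      using pos by simp
    then show ?thesis using sum by (simp add: algebra_simps)
  qed
  have eig: "(\<Sum>u\<in>parcs ?B `` {v}. x u) = (r - 1) * x v" if v: "v \<in> pverts ?B" for v
  proof -
    consider "v = 0" | "0 < v" "v < s" | "s \<le> v" "v < s + i" | "s + i \<le> v"
      by linarith
    then show ?thesis
    proof cases
      case 1
      then have "parcs ?B `` {v} = ({..<s} - {v}) \<union> {s..<s + i}"
        using s i by (auto simp: B_graph_def)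
      then have "(\<Sum>u\<in>parcs ?B `` {v}. x u) = (\<Sum>u\<in>({..<s} - {v}) \<union> {s..<s + i}. x u)"
        by (rule arg_cong)
      also have "\<dots> = (\<Sum>u\<in>{..<s} - {v}. x u) + (\<Sum>u\<in>{s..<s + i}. x u)"
        by (rule sum.union_disjoint) auto
      also have "\<dots> = r * \<alpha> - x v + real i * r"
        using 1 s by (simp add: sum_diff1 low mid)
      finally show ?thesis
        using 1 by (simp add: x_def algebra_simps)
    next
      case 2
      then have "parcs ?B `` {v} = {..<s} - {v}"
        by (auto simp: B_graph_def)
      then show ?thesis
        using 2 by (simp add: sum_diff1 low) (simp add: x_def algebra_simps)
    next
      case 3
      then have "parcs ?B `` {v} = insert 0 ({s..<n} - {v})"
        using s i by (auto simp: B_graph_def)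
      then have "(\<Sum>u\<in>parcs ?B `` {v}. x u) = x 0 + (\<Sum>u\<in>{s..<n} - {v}. x u)"
        using s by simp
      also have "\<dots> = x 0 + (r * q - x v)"
        using 3 v by (simp add: B_graph_def sum_diff1 high)
      also have "\<dots> = r * r - x v"
        using rq by (simp add: x_def)
      finally show ?thesis
        using 3 s by (simp add: x_def algebra_simps)
    next
      case 4
      then have "parcs ?B `` {v} = {s..<n} - {v}"
        using s v by (auto simp: B_graph_def)
      then show ?thesis
        using 4 s v by (simp add: sum_diff1 high B_graph_def) (simp add: x_def algebra_simps)
    qed
  qed
  have "pair_graph ?B"
    using s i by (intro pair_graph_B_graph) auto
  moreover have "0 \<in> pverts ?B" "x 0 \<noteq> 0"
    using s i root(1) by (auto simp: B_graph_def x_def)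
  ultimately show ?thesis
    using eigenvalue_le_graph_rho[of ?B 0 x "r - 1"] eig by blast
qed

section \<open>Counting the arcs of a sparse partition\<close>

locale min_degree_graph =
  fixes V :: "'a set" and A :: "'a rel" and \<delta> :: nat
  assumes fin: "finite V" and arcs: "A \<subseteq> V \<times> V"
    and sym: "(u, v) \<in> A \<Longrightarrow> (v, u) \<in> A" and irrefl: "(u, u) \<notin> A"
    and min_deg: "v \<in> V \<Longrightarrow> \<delta> \<le> card (A `` {v})"
begin

definition boundary :: "'a set \<Rightarrow> 'a rel" where
  "boundary U = {(u, v) \<in> A. u \<in> U \<and> v \<notin> U}"

definition cross_arcs :: "'a set set \<Rightarrow> 'a rel" where
  "cross_arcs P = {(u, v) \<in> A. \<not> (\<exists>U\<in>P. u \<in> U \<and> v \<in> U)}"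

lemma finite_arcs: "finite A"
  using arcs fin finite_subset by blast

lemma finite_neighbours: "finite (A `` {v})"
  using finite_arcs by (rule finite_Image)

lemma neighbours_subset: "A `` {v} \<subseteq> V"
  using arcs by auto

lemma card_arcs: "card A = (\<Sum>v\<in>V. card (A `` {v}))"
proof -
  have "A = Sigma V (\<lambda>v. A `` {v})"
    using arcs by auto
  then have "card A = card (Sigma V (\<lambda>v. A `` {v}))"
    by (rule arg_cong)
  also have "\<dots> = (\<Sum>v\<in>V. card (A `` {v}))"
    by (rule card_SigmaI) (use fin finite_neighbours in auto)
  finally show ?thesis .
qed

text \<open>
  A vertex of a set \<open>U\<close> has at most \<open>card U - 1\<close> neighbours in \<open>U\<close>, so a nonempty set of at most
  \<open>\<delta>\<close> vertices has at least \<open>card U * (\<delta> + 1 - card U) \<ge> \<delta>\<close> arcs leaving it.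
\<close>

lemma card_gt_if_small_boundary:
  assumes U: "U \<subseteq> V" "U \<noteq> {}" and small: "card (boundary U) < \<delta>"
  shows "\<delta> < card U"
proof (rule ccontr)
  assume "\<not> \<delta> < card U"
  then obtain d where d: "\<delta> = card U + d"
    by (metis le_Suc_ex not_less)
  have finU: "finite U"
    using U fin finite_subset by blast
  have out: "d + 1 \<le> card (A `` {u} - U)" if u: "u \<in> U" for u
  proof -
    have "A `` {u} \<subseteq> (A `` {u} - U) \<union> (U - {u})"
      using irrefl by auto
    then have "card (A `` {u}) \<le> card ((A `` {u} - U) \<union> (U - {u}))"
      using finU finite_neighbours by (intro card_mono) auto
    also have "\<dots> \<le> card (A `` {u} - U) + card (U - {u})"
      by (rule card_Un_le)
    also have "card (U - {u}) = card U - 1"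
      using u finU by simp
    finally show ?thesis
      using min_deg[of u] U u finU d card_gt_0_iff[of U] by auto
  qed
  have "boundary U = Sigma U (\<lambda>u. A `` {u} - U)"
    by (auto simp: boundary_def)
  then have "card (boundary U) = (\<Sum>u\<in>U. card (A `` {u} - U))"
    using finU finite_neighbours by simp
  also have "\<dots> \<ge> card U * (d + 1)"
    using sum_bounded_below[of U "d + 1" "\<lambda>u. card (A `` {u} - U)"] out by simp
  finally have "card U * (d + 1) < card U + d"
    using small d by linarith
  moreover have "1 * d \<le> card U * d"
    using U finU by (intro mult_right_mono) (simp_all add: card_gt_0_iff Suc_le_eq)
  ultimately show False
    unfolding distrib_left mult_1_left mult_1_right by linarith
qed

lemma card_cross_arcs:
  assumes P: "partition_on V P"
  shows "card (cross_arcs P) = (\<Sum>U\<in>P. card (boundary U))"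
proof -
  have finP: "finite P"
    using P fin by (rule finite_elements[rotated])
  have uniq: "U = U'" if "u \<in> U" "u \<in> U'" "U \<in> P" "U' \<in> P" for u U U'
    using that P by (auto simp: partition_on_def disjoint_def)
  have "cross_arcs P = (\<Union>U\<in>P. boundary U)"
  proof (intro equalityI subrelI)
    fix u v assume uv: "(u, v) \<in> cross_arcs P"
    then have "u \<in> V" using arcs by (auto simp: cross_arcs_def)
    then obtain U where "U \<in> P" "u \<in> U"
      using P by (auto simp: partition_on_def)
    then show "(u, v) \<in> (\<Union>U\<in>P. boundary U)"
      using uv by (auto simp: cross_arcs_def boundary_def)
  next
    fix u v assume "(u, v) \<in> (\<Union>U\<in>P. boundary U)"
    then obtain U where U: "U \<in> P" "(u, v) \<in> A" "u \<in> U" "v \<notin> U"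
      by (auto simp: boundary_def)
    have "v \<notin> W" if "W \<in> P" "u \<in> W" for W
      using uniq[OF U(3) that(2) U(1) that(1)] U(4) by simp
    then show "(u, v) \<in> cross_arcs P"
      using U(2) by (auto simp: cross_arcs_def)
  qed
  moreover have "card (\<Union>U\<in>P. boundary U) = (\<Sum>U\<in>P. card (boundary U))"
  proof (rule card_UN_disjoint)
    show "\<forall>U\<in>P. finite (boundary U)"
      using finite_arcs by (auto simp: boundary_def intro: finite_subset)
    show "\<forall>U\<in>P. \<forall>U'\<in>P. U \<noteq> U' \<longrightarrow> boundary U \<inter> boundary U' = {}"
    proof (intro ballI impI)
      fix U U' assume "U \<in> P" "U' \<in> P" "U \<noteq> U'"
      then have "U \<inter> U' = {}" using uniq by blast
      then show "boundary U \<inter> boundary U' = {}" by (auto simp: boundary_def)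
    qed
  qed (rule finP)
  ultimately show ?thesis by simp
qed

lemma card_cross_arcs_le_edges:
  assumes P: "partition_on V P"
  shows "card (cross_arcs P)
    \<le> 2 * card {e \<in> (\<lambda>(u, v). {u, v}) ` A. \<not> (\<exists>U\<in>P. e \<subseteq> U)}"
proof -
  let ?E = "{e \<in> (\<lambda>(u, v). {u, v}) ` A. \<not> (\<exists>U\<in>P. e \<subseteq> U)}"
  let ?f = "\<lambda>e. {(u, v). e = {u, v}}"
  have fiber: "finite (?f e) \<and> card (?f e) \<le> 2" if "e \<in> ?E" for e
  proof -
    have "e \<in> (\<lambda>(u, v). {u, v}) ` A"
      using that by (simp only: mem_Collect_eq)
    then obtain a b where e: "e = {a, b}"
      by (elim imageE) (simp add: case_prod_beta)
    have sub: "?f e \<subseteq> {(a, b), (b, a)}"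
      unfolding e by (auto simp: doubleton_eq_iff)
    then have "finite (?f e)"
      by (rule finite_subset) simp
    moreover have "card (?f e) \<le> card {(a, b), (b, a)}"
      by (rule card_mono[OF _ sub]) simp
    moreover have "card {(a, b), (b, a)} \<le> 2"
      using card_length[of "[(a, b), (b, a)]"] by simp
    ultimately show ?thesis
      by (intro conjI) (assumption, rule le_trans)
  qed
  have finE: "finite ?E"
    using finite_arcs by simp
  have "cross_arcs P \<subseteq> (\<Union>e\<in>?E. ?f e)"
    by (force simp: cross_arcs_def)
  then have "card (cross_arcs P) \<le> card (\<Union>e\<in>?E. ?f e)"
    using finE fiber by (intro card_mono finite_UN_I) auto
  also have "\<dots> \<le> (\<Sum>e\<in>?E. card (?f e))"
    using finE by (rule card_UN_le)
  also have "\<dots> \<le> card ?E * 2"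
    using sum_bounded_above[of ?E "\<lambda>e. card (?f e)" 2] fiber by simp
  finally show ?thesis by simp
qed

text \<open>
  The boundaries of the parts have total size less than \<open>2 k (card P - 1)\<close>, so at least two of them
  are smaller than \<open>2 k \<le> \<delta>\<close>.
\<close>

lemma two_large_parts:
  assumes P: "partition_on V P" and sparse: "card (cross_arcs P) + 2 * k < 2 * k * card P"
    and k: "2 * k \<le> \<delta>"
  shows "\<exists>U\<in>P. \<exists>U'\<in>P. U \<noteq> U' \<and> \<delta> < card U \<and> \<delta> < card U'"
proof (rule ccontr)
  assume none: "\<not> ?thesis"
  define L where "L = {U \<in> P. card (boundary U) < 2 * k}"
  have finP: "finite P"
    using P fin by (rule finite_elements[rotated])
  have "\<delta> < card U" if "U \<in> L" for U
    using that P k by (intro card_gt_if_small_boundary) (auto simp: L_def partition_on_def)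
  then have "\<forall>U\<in>L. \<forall>U'\<in>L. U = U'"
    using none by (auto simp: L_def)
  then have L: "card L \<le> 1"
    using card_le_Suc0_iff_eq[of L] finP by (auto simp: L_def)
  have "2 * k * card P = (\<Sum>U\<in>P. 2 * k)"
    by simp
  also have "\<dots> = (\<Sum>U\<in>P - L. 2 * k) + (\<Sum>U\<in>L. 2 * k)"
    by (rule sum.subset_diff) (use finP in \<open>auto simp: L_def\<close>)
  also have "\<dots> \<le> (\<Sum>U\<in>P - L. card (boundary U)) + 2 * k"
  proof (rule add_mono)
    show "(\<Sum>U\<in>P - L. 2 * k) \<le> (\<Sum>U\<in>P - L. card (boundary U))"
      by (rule sum_mono) (auto simp: L_def)
    show "(\<Sum>U\<in>L. 2 * k) \<le> 2 * k"
      using mult_right_mono[OF L, of "2 * k"] by simp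
  qed
  also have "(\<Sum>U\<in>P - L. card (boundary U)) \<le> card (cross_arcs P)"
    unfolding card_cross_arcs[OF P] using finP by (intro sum_mono2) auto
  finally show False
    using sparse by simp
qed

lemma card_arcs_le_parts:
  assumes P: "partition_on V P"
  shows "card A \<le> (\<Sum>U\<in>P. card U * (card U - 1)) + card (cross_arcs P)"
proof -
  have finP: "finite P"
    using P fin by (rule finite_elements[rotated])
  have finU: "finite U" if "U \<in> P" for U
  proof -
    have "U \<subseteq> V"
      using that P by (auto simp: partition_on_def)
    then show ?thesis
      using fin by (rule finite_subset)
  qed
  let ?I = "\<lambda>U. Sigma U (\<lambda>u. U - {u})"
  have cardI: "card (?I U) = card U * (card U - 1)" if "U \<in> P" for U
    using finU[OF that] by simp
  have finI: "finite (?I U)" if "U \<in> P" for U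
    using finU[OF that] by simp
  have fc: "finite (cross_arcs P)"
    using finite_arcs by (auto simp: cross_arcs_def intro: finite_subset)
  have "A \<subseteq> (\<Union>U\<in>P. ?I U) \<union> cross_arcs P"
    using irrefl by (auto simp: cross_arcs_def)
  then have "card A \<le> card ((\<Union>U\<in>P. ?I U) \<union> cross_arcs P)"
    using finP finI fc by (intro card_mono) auto
  also have "\<dots> \<le> card (\<Union>U\<in>P. ?I U) + card (cross_arcs P)"
    by (rule card_Un_le)
  also have "card (\<Union>U\<in>P. ?I U) \<le> (\<Sum>U\<in>P. card (?I U))"
    by (rule card_UN_le[OF finP])
  also have "\<dots> = (\<Sum>U\<in>P. card U * (card U - 1))"
    using cardI by (intro sum.cong) auto
  finally show ?thesis by simp
qed

text \<open>
  By convexity the number of arcs inside the parts is largest if all parts but two are singletons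
  and the smaller of the two has only \<open>\<delta> + 1\<close> vertices; \<open>L + 1\<close> is the order of the larger one.
\<close>

lemma sum_parts_le:
  assumes P: "partition_on V P" and U: "U \<in> P" "U' \<in> P" "U \<noteq> U'" "\<delta> < card U" "\<delta> < card U'"
  shows "\<exists>L. L + \<delta> + card P = card V \<and> \<delta> \<le> L \<and>
    (\<Sum>U\<in>P. card U * (card U - 1)) \<le> (\<delta> + 1) * \<delta> + (L + 1) * L"
proof -
  have finP: "finite P"
    using P fin by (rule finite_elements[rotated])
  define g where "g U = card U - 1" for U :: "'a set"
  have card: "card W = g W + 1" if "W \<in> P" for W
  proof -
    have "W \<subseteq> V" "W \<noteq> {}"
      using that P by (auto simp: partition_on_def)
    moreover from this have "finite W"
      using fin finite_subset by blast
    ultimately show ?thesis by (simp add: g_def Suc_leI card_gt_0_iff)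
  qed
  let ?G = "sum g (P - {U})"
  have "card V = (\<Sum>W\<in>P. card W)"
    using P fin card_Union_disjoint[of P] finite_subset
    by (metis (no_types, lifting) Sup_upper disjnt_def disjoint_def pairwise_def partition_onD1
        partition_onD2)
  also have "\<dots> = (\<Sum>W\<in>P. g W + 1)"
    by (intro sum.cong) (simp_all add: card)
  also have "\<dots> = sum g P + card P"
    by (subst sum.distrib) simp
  also have "sum g P = g U + ?G"
    by (rule sum.remove[OF finP U(1)])
  finally have V: "card V = g U + ?G + card P" .
  have gU: "\<delta> \<le> g U" "\<delta> \<le> g U'"
    using U card[OF U(1)] card[OF U(2)] by auto
  have mem: "g W \<le> ?G" if "W \<in> P - {U}" for W
    using that finP by (intro member_le_sum) auto
  then have G: "\<delta> \<le> ?G"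
    using gU(2) U by force
  obtain p q where pq: "g U = \<delta> + p" "?G = \<delta> + q"
    using gU(1) G le_Suc_ex by metis
  have "(\<Sum>W\<in>P. card W * (card W - 1)) = (\<Sum>W\<in>P. (g W + 1) * g W)"
    using card by (intro sum.cong) auto
  also have "\<dots> = (g U + 1) * g U + (\<Sum>W\<in>P - {U}. (g W + 1) * g W)"
    by (rule sum.remove[OF finP U(1)])
  also have "(\<Sum>W\<in>P - {U}. (g W + 1) * g W) \<le> (\<Sum>W\<in>P - {U}. (?G + 1) * g W)"
    using mem by (intro sum_mono mult_right_mono) auto
  also have "\<dots> = (?G + 1) * ?G"
    by (simp only: sum_distrib_left)
  also have "(g U + 1) * g U + (?G + 1) * ?G \<le> (\<delta> + 1) * \<delta> + (\<delta> + p + q + 1) * (\<delta> + p + q)"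
    unfolding pq by (simp add: algebra_simps)
  finally show ?thesis
    using V pq by (intro exI[of _ "\<delta> + p + q"]) simp
qed

lemma card_arcs_le_three_parts:
  assumes P: "partition_on V P" and sparse: "card (cross_arcs P) + 2 * k < 2 * k * card P"
    and k: "2 * k \<le> \<delta>" and three: "3 \<le> card P"
  shows "real (card A) \<le> (real (card V) - 1) * real \<delta>
    + (real (card V) - 2 * real \<delta> - 1) * (real (card V) - real \<delta> - 2)"
proof -
  obtain U U' where "U \<in> P" "U' \<in> P" "U \<noteq> U'" "\<delta> < card U" "\<delta> < card U'"
    using two_large_parts[OF P sparse k] by blast
  from sum_parts_le[OF P this] obtain L where L: "L + \<delta> + card P = card V" "\<delta> \<le> L"
    "(\<Sum>U\<in>P. card U * (card U - 1)) \<le> (\<delta> + 1) * \<delta> + (L + 1) * L"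
    by blast
  obtain p where p: "card P = p + 3"
    using three le_Suc_ex by (metis add.commute)
  have "2 * k * card P = 2 * k * (p + 2) + 2 * k"
    unfolding p by (simp add: algebra_simps)
  then have "card (cross_arcs P) \<le> 2 * k * (p + 2)"
    using sparse by linarith
  also have "\<dots> \<le> \<delta> * (p + 2)"
    using k by (rule mult_right_mono) simp
  finally have "card A \<le> (\<delta> + 1) * \<delta> + (L + 1) * L + \<delta> * (p + 2)"
    using card_arcs_le_parts[OF P] L(3) by linarith
  then have "real (card A) \<le> real ((\<delta> + 1) * \<delta> + (L + 1) * L + \<delta> * (p + 2))"
    by (simp only: of_nat_le_iff)
  moreover define d l q where defs: "d = real \<delta>" "l = real L - real \<delta>" "q = real p"
  moreover have n: "real (card V) = l + 2 * d + q + 3"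
    using L(1) p unfolding defs by linarith
  ultimately have "real (card A) \<le> (d + 1) * d + (d + l + 1) * (d + l) + d * (q + 2)"
    by (simp add: algebra_simps)
  also have "\<dots> \<le> (d + 1) * d + (d + l + 1) * (d + l) + d * (q + 2)
      + (q * q + d * q + 2 * l * q + 2 * l + 3 * q + 2)"
  proof -
    have "0 \<le> d" "0 \<le> l" "0 \<le> q"
      using L(2) by (simp_all add: defs)
    then have "0 \<le> q * q + d * q + 2 * l * q + 2 * l + 3 * q + 2"
      by (intro add_nonneg_nonneg mult_nonneg_nonneg) simp_all
    then show ?thesis by simp
  qed
  also have "\<dots> = (real (card V) - 1) * d + (real (card V) - 2 * d - 1) * (real (card V) - d - 2)"
    unfolding n by (simp add: algebra_simps)
  finally show ?thesis
    unfolding defs .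
qed

text \<open>
  For a vertex \<open>v\<close> of degree \<open>d\<close> the degrees of its neighbours sum to at most
  \<open>card A - d - (n - 1 - d) \<delta>\<close>, since the remaining vertices have degree at least \<open>\<delta>\<close>.  This makes
  the degree plus a constant \<open>t\<close> a supersolution, which is the bound of Hong, Shu and Fang.
\<close>

lemma degree_supersolution:
  assumes v: "v \<in> V"
    and m: "real (card A) \<le> (real (card V) - 1) * real \<delta> + t * (t + real \<delta> - 1)"
  shows "(\<Sum>u\<in>A `` {v}. real (card (A `` {u})) + t)
    \<le> (t + real \<delta> - 1) * (real (card (A `` {v})) + t)"
proof -
  let ?d = "\<lambda>u. real (card (A `` {u}))"
  let ?N = "A `` {v}"
  have sub: "insert v ?N \<subseteq> V" "v \<notin> ?N"
    using neighbours_subset irrefl v by auto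
  have finN: "finite ?N"
    by (rule finite_neighbours)
  have "card (insert v ?N) \<le> card V"
    using fin sub by (intro card_mono) auto
  then have card: "real (card (V - insert v ?N)) = real (card V) - 1 - ?d v"
    using fin sub finN by (subst card_Diff_subset) (auto simp: of_nat_diff)
  have "real (card A) = (\<Sum>u\<in>V. ?d u)"
    by (simp add: card_arcs)
  also have "\<dots> = (\<Sum>u\<in>V - insert v ?N. ?d u) + (?d v + (\<Sum>u\<in>?N. ?d u))"
    using sum.subset_diff[OF sub(1) fin, of ?d] sub(2) finN by simp
  finally have "real (card A) = (\<Sum>u\<in>V - insert v ?N. ?d u) + (?d v + (\<Sum>u\<in>?N. ?d u))" .
  moreover have "real (card (V - insert v ?N)) * real \<delta> \<le> (\<Sum>u\<in>V - insert v ?N. ?d u)"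
    using sum_bounded_below[of "V - insert v ?N" "real \<delta>" ?d] min_deg by simp
  ultimately have "(\<Sum>u\<in>?N. ?d u) \<le> real (card A) - ?d v - (real (card V) - 1 - ?d v) * real \<delta>"
    unfolding card by linarith
  then have le: "(\<Sum>u\<in>?N. ?d u) \<le> (real (card V) - 1) * real \<delta> + t * (t + real \<delta> - 1)
      - ?d v - (real (card V) - 1 - ?d v) * real \<delta>"
    by (rule order_trans) (simp only: diff_right_mono m)
  have "(\<Sum>u\<in>?N. ?d u + t) = (\<Sum>u\<in>?N. ?d u) + ?d v * t"
    by (simp add: sum.distrib)
  also have "\<dots> \<le> (real (card V) - 1) * real \<delta> + t * (t + real \<delta> - 1)
      - ?d v - (real (card V) - 1 - ?d v) * real \<delta> + ?d v * t"
    by (rule add_right_mono[OF le])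
  also have "\<dots> = (t + real \<delta> - 1) * (?d v + t)"
  proof -
    have "(n - 1) * c + t * (t + c - 1) - d - (n - 1 - d) * c + d * t = (t + c - 1) * (d + t)"
      for n c d :: real
      by (simp add: algebra_simps)
    then show ?thesis .
  qed
  finally show ?thesis .
qed

end

section \<open>Isomorphism with the extremal graph\<close>

lemma digraph_isoI:
  assumes G: "pair_graph G" and H: "pair_graph H"
    and h: "bij_betw h (pverts G) (pverts H)"
    and arcs: "\<And>u v. u \<in> pverts G \<Longrightarrow> v \<in> pverts G \<Longrightarrow>
      (u, v) \<in> parcs G \<longleftrightarrow> (h u, h v) \<in> parcs H"
  shows "digraph_iso (with_proj G) (with_proj H)"
proof -
  interpret G: pair_graph G by (rule G)
  interpret H: pair_graph H by (rule H)
  let ?f = "\<lparr> iso_verts = h, iso_arcs = map_prod h h, iso_head = snd, iso_tail = fst \<rparr>"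
  have inj: "inj_on h (pverts G)" and img: "h ` pverts G = pverts H"
    using h by (auto simp: bij_betw_def)
  have sub: "parcs G \<subseteq> pverts G \<times> pverts G"
    using G.in_arcsD1 G.in_arcsD2 by auto
  have "map_prod h h ` parcs G = parcs H"
  proof (intro equalityI subrelI)
    fix a b assume "(a, b) \<in> map_prod h h ` parcs G"
    then show "(a, b) \<in> parcs H"
      using arcs sub by auto
  next
    fix a b assume ab: "(a, b) \<in> parcs H"
    then have "a \<in> h ` pverts G" "b \<in> h ` pverts G"
      using H.in_arcsD1 H.in_arcsD2 img by auto
    then obtain u v where "u \<in> pverts G" "v \<in> pverts G" "a = h u" "b = h v"
      by blast
    then show "(a, b) \<in> map_prod h h ` parcs G"
      using arcs ab by (intro image_eqI[of _ _ "(u, v)"]) auto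
  qed
  then have "with_proj H = app_iso ?f (with_proj G)"
    using img by (simp add: app_iso_def with_proj_def)
  moreover have "inj_on (map_prod h h) (parcs G)"
    using map_prod_inj_on[OF inj inj] sub by (rule inj_on_subset)
  then have "pre_digraph.digraph_isomorphism (with_proj G) ?f"
    using inj G.wf_digraph_axioms by (auto simp: pre_digraph.digraph_isomorphism_def)
  ultimately show ?thesis
    unfolding digraph_iso_def by blast
qed

lemma two_cliques_with_star_iso_B_graph:
  assumes G: "pair_graph G" and V: "pverts G = V\<^sub>1 \<union> V\<^sub>2" "V\<^sub>1 \<inter> V\<^sub>2 = {}"
    and card: "card V\<^sub>1 = s" "card (pverts G) = n"
    and c: "c \<in> V\<^sub>1" and W: "W \<subseteq> V\<^sub>2"
    and arcs: "parcs G = {(u, v). u \<in> V\<^sub>1 \<and> v \<in> V\<^sub>1 \<and> u \<noteq> v}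
      \<union> {(u, v). u \<in> V\<^sub>2 \<and> v \<in> V\<^sub>2 \<and> u \<noteq> v} \<union> {c} \<times> W \<union> W \<times> {c}"
  shows "digraph_iso (with_proj G) (with_proj (B_graph n s (card W)))"
proof -
  interpret G: pair_graph G by (rule G)
  let ?i = "card W"
  have fin: "finite V\<^sub>1" "finite V\<^sub>2" "finite W"
    using G.pair_finite_verts V W finite_subset by auto
  have s: "0 < s"
    using c fin card by (auto simp: card_gt_0_iff)
  have n: "n = s + card V\<^sub>2"
    using card V fin by (simp add: card_Un_disjoint)
  have i: "?i \<le> card V\<^sub>2"
    using W fin by (simp add: card_mono)
  obtain f\<^sub>1 where f1: "bij_betw f\<^sub>1 (V\<^sub>1 - {c}) {1..<s}"
    using finite_same_card_bij[of "V\<^sub>1 - {c}" "{1..<s}"] fin c card by auto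
  obtain f\<^sub>2 where f2: "bij_betw f\<^sub>2 W {s..<s + ?i}"
    using finite_same_card_bij[of W "{s..<s + ?i}"] fin by auto
  obtain f\<^sub>3 where f3: "bij_betw f\<^sub>3 (V\<^sub>2 - W) {s + ?i..<n}"
    using finite_same_card_bij[of "V\<^sub>2 - W" "{s + ?i..<n}"] fin W n by (auto simp: card_Diff_subset)
  define h where "h x = (if x = c then 0 else if x \<in> V\<^sub>1 then f\<^sub>1 x else if x \<in> W then f\<^sub>2 x else f\<^sub>3 x)"
    for x
  have "bij_betw h {c} {0}"
    by (simp add: h_def bij_betw_def)
  moreover have h1: "bij_betw h (V\<^sub>1 - {c}) {1..<s}"
    using f1 by (subst bij_betw_cong[of _ _ f\<^sub>1]) (auto simp: h_def)
  moreover have h2: "bij_betw h W {s..<s + ?i}"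
    using f2 V W c by (subst bij_betw_cong[of _ _ f\<^sub>2]) (auto simp: h_def)
  moreover have h3: "bij_betw h (V\<^sub>2 - W) {s + ?i..<n}"
    using f3 V c by (subst bij_betw_cong[of _ _ f\<^sub>3]) (auto simp: h_def)
  ultimately have "bij_betw h ((({c} \<union> (V\<^sub>1 - {c})) \<union> W) \<union> (V\<^sub>2 - W))
      ((({0} \<union> {1..<s}) \<union> {s..<s + ?i}) \<union> {s + ?i..<n})"
    by (intro bij_betw_combine) (use s in auto)
  moreover have "(({c} \<union> (V\<^sub>1 - {c})) \<union> W) \<union> (V\<^sub>2 - W) = pverts G"
    using V c W by auto
  moreover have "(({0} \<union> {1..<s}) \<union> {s..<s + ?i}) \<union> {s + ?i..<n} = {..<n}"
    using s n i by auto
  ultimately have bij: "bij_betw h (pverts G) {..<n}"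
    by simp
  have in1: "h u < s" if "u \<in> V\<^sub>1" for u
    using that h1 s by (cases "u = c") (auto simp: h_def bij_betw_def)
  have in2: "s \<le> h u \<and> h u < n \<and> (h u < s + ?i \<longleftrightarrow> u \<in> W)" if "u \<in> V\<^sub>2" for u
  proof (cases "u \<in> W")
    case True
    then have "h u \<in> {s..<s + ?i}" using h2 by (auto simp: bij_betw_def)
    then show ?thesis using True n i by auto
  next
    case False
    then have "h u \<in> {s + ?i..<n}" using h3 that by (auto simp: bij_betw_def)
    then show ?thesis using False by auto
  qed
  have hc: "h c = 0"
    by (simp add: h_def)
  have inj: "h u = h v \<longleftrightarrow> u = v" if "u \<in> pverts G" "v \<in> pverts G" for u v
    using bij that by (auto simp: bij_betw_def inj_on_eq_iff)
  have h0: "h u = 0 \<longleftrightarrow> u = c" if "u \<in> pverts G" for u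
    using inj[OF that, of c] hc c V by auto
  have "(u, v) \<in> parcs G \<longleftrightarrow> (h u, h v) \<in> parcs (B_graph n s ?i)"
    if uv: "u \<in> pverts G" "v \<in> pverts G" for u v
  proof -
    have not2: "x \<notin> V\<^sub>2" "x \<notin> W" if "x \<in> V\<^sub>1" for x
      using that V W by auto
    have not1: "x \<notin> V\<^sub>1" "x \<noteq> c" if "x \<in> V\<^sub>2" for x
      using that V c by auto
    consider "u \<in> V\<^sub>1" "v \<in> V\<^sub>1" | "u \<in> V\<^sub>1" "v \<in> V\<^sub>2" | "u \<in> V\<^sub>2" "v \<in> V\<^sub>1" | "u \<in> V\<^sub>2" "v \<in> V\<^sub>2"
      using uv V by blast
    then show ?thesis
    proof cases
      case 1
      then show ?thesis
        using in1[OF 1(1)] in1[OF 1(2)] not2[OF 1(1)] not2[OF 1(2)] inj[OF uv]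
        by (auto simp: arcs B_graph_def)
    next
      case 2
      then show ?thesis
        using in1[OF 2(1)] in2[OF 2(2)] not2[OF 2(1)] not1[OF 2(2)] h0[OF uv(1)]
        by (auto simp: arcs B_graph_def)
    next
      case 3
      then show ?thesis
        using in2[OF 3(1)] in1[OF 3(2)] not1[OF 3(1)] not2[OF 3(2)] h0[OF uv(2)]
        by (auto simp: arcs B_graph_def)
    next
      case 4
      then show ?thesis
        using in2[OF 4(1)] in2[OF 4(2)] not1[OF 4(1)] not1[OF 4(2)] inj[OF uv] s
        by (auto simp: arcs B_graph_def)
    qed
  qed
  moreover have "pair_graph (B_graph n s ?i)"
    using s n i by (intro pair_graph_B_graph) auto
  moreover have "bij_betw h (pverts G) (pverts (B_graph n s ?i))"
    using bij by (simp add: B_graph_def)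
  ultimately show ?thesis
    using digraph_isoI[OF G] by blast
qed

section \<open>Comparison with the extremal graph\<close>

lemma min_degree_le_neighbours:
  assumes G: "pair_graph G" and v: "v \<in> pverts G"
  shows "min_degree G \<le> card (parcs G `` {v})"
proof -
  interpret G: pair_graph G by (rule G)
  have "parcs G `` {v} = snd ` out_arcs (with_proj G) v"
    by (force simp: out_arcs_def)
  moreover have "inj_on snd (out_arcs (with_proj G) v)"
    by (auto simp: inj_on_def out_arcs_def)
  ultimately have "card (parcs G `` {v}) = out_degree (with_proj G) v"
    by (simp add: card_image out_degree_def)
  then show ?thesis
    unfolding min_degree_def using G.pair_finite_verts v by auto
qed

lemma bipartitioned_graph_if_pair_graph:
  assumes G: "pair_graph G" and V: "pverts G = V\<^sub>1 \<union> V\<^sub>2" "V\<^sub>1 \<inter> V\<^sub>2 = {}"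
  shows "bipartitioned_graph V\<^sub>1 V\<^sub>2 (parcs G)"
proof -
  interpret G: pair_graph G by (rule G)
  show ?thesis
  proof
    show "finite V\<^sub>1" "finite V\<^sub>2"
      using G.pair_finite_verts V by auto
    show "parcs G \<subseteq> (V\<^sub>1 \<union> V\<^sub>2) \<times> (V\<^sub>1 \<union> V\<^sub>2)"
      using G.in_arcsD1 G.in_arcsD2 V by auto
    show "(u, v) \<in> parcs G \<Longrightarrow> (v, u) \<in> parcs G" for u v
      using G.pair_sym_arcs by (auto simp: symmetric_def dest: symD)
    show "(u, u) \<notin> parcs G" for u
      using G.pair_no_loops[of "(u, u)"] by auto
  qed (rule V)
qed

lemma connected_cross_arc:
  assumes G: "pair_graph G" and conn: "Digraph_Component.connected (with_proj G)"
    and V: "pverts G = V\<^sub>1 \<union> V\<^sub>2" "V\<^sub>1 \<inter> V\<^sub>2 = {}" and ne: "V\<^sub>1 \<noteq> {}" "V\<^sub>2 \<noteq> {}"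
  shows "parcs G \<inter> V\<^sub>1 \<times> V\<^sub>2 \<noteq> {}"
proof
  interpret G: pair_graph G by (rule G)
  assume none: "parcs G \<inter> V\<^sub>1 \<times> V\<^sub>2 = {}"
  obtain u v where uv: "u \<in> V\<^sub>1" "v \<in> V\<^sub>2"
    using ne by blast
  have "(u, v) \<in> (parcs G)\<^sup>*"
    by (rule connected_imp_rtrancl[OF G conn]) (use uv V in auto)
  then have "v \<in> V\<^sub>1"
  proof (induction rule: rtrancl_induct)
    case (step a b)
    then have "b \<in> V\<^sub>1 \<union> V\<^sub>2"
      using G.in_arcsD2 V by auto
    then show ?case
      using step none by blast
  qed (rule uv)
  then show False
    using uv V by blast
qed

lemma B_graph_rho_root:
  assumes "0 < s" "2 * s < n" "1 \<le> i" "i \<le> n - s"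
  shows "\<exists>r \<alpha>. real (n - s) < r \<and> 0 < \<alpha> \<and> \<alpha> * (r - real s) = real i \<and>
    r\<^sup>2 * (r - real (n - s)) = (\<alpha> + real i) * (real i + (r - real (n - s))) \<and>
    r - 1 \<le> graph_rho (B_graph n s i)"
proof -
  have "1 \<le> real s" "real s + 1 \<le> real (n - s)" "1 \<le> real i"
    using assms by linarith+
  from star_root_exists[OF this] obtain r \<alpha> where "real (n - s) < r" "0 < \<alpha>"
    "\<alpha> * (r - real s) = real i"
    "r\<^sup>2 * (r - real (n - s)) = (\<alpha> + real i) * (real i + (r - real (n - s)))"
    by blast
  moreover from this have "r - 1 \<le> graph_rho (B_graph n s i)"
    using assms by (intro B_graph_rho_ge) auto
  ultimately show ?thesis by blast
qed

lemma B_graph_rho_gt_clique: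
  assumes "0 < s" "2 * s < n" "1 \<le> i" "i \<le> n - s"
  shows "real n - real s - 1 < graph_rho (B_graph n s i)"
proof -
  have "real (n - s) = real n - real s"
    using assms by (simp add: of_nat_diff)
  then show ?thesis
    using B_graph_rho_root[OF assms] by (smt (verit))
qed

text \<open>
  The spectral radius of \<open>G\<close> is at most \<open>r - 1\<close> by the comparison with the star and at least \<open>r - 1\<close> by
  assumption, so the supersolution has no slack.
\<close>

lemma two_parts_extremal:
  assumes G: "pair_graph G" and conn: "Digraph_Component.connected (with_proj G)"
    and V: "pverts G = V\<^sub>1 \<union> V\<^sub>2" "V\<^sub>1 \<inter> V\<^sub>2 = {}"
    and card: "card V\<^sub>1 = s" "card (pverts G) = n" "0 < s" "2 * s < n"
    and i: "1 \<le> i" "i \<le> n - s" "card (parcs G \<inter> V\<^sub>1 \<times> V\<^sub>2) \<le> i"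
    and rho: "graph_rho G \<ge> graph_rho (B_graph n s i)"
  shows "digraph_iso (with_proj G) (with_proj (B_graph n s i))"
proof -
  interpret bipartitioned_graph V\<^sub>1 V\<^sub>2 "parcs G"
    by (rule bipartitioned_graph_if_pair_graph[OF G V])
  have card2: "card V\<^sub>2 = n - s"
    using card V fin by (simp add: card_Un_disjoint)
  have ne: "V\<^sub>1 \<noteq> {}" "V\<^sub>2 \<noteq> {}"
    using card card2 by auto
  obtain r \<alpha> where r: "real (n - s) < r" "0 < \<alpha>" "\<alpha> * (r - real s) = real i"
    "r\<^sup>2 * (r - real (n - s)) = (\<alpha> + real i) * (real i + (r - real (n - s)))"
    "r - 1 \<le> graph_rho (B_graph n s i)"
    using B_graph_rho_root[OF card(3,4) i(1,2)] by blast
  have "parcs G \<inter> V\<^sub>1 \<times> V\<^sub>2 \<noteq> {}"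
    by (rule connected_cross_arc[OF G conn V ne])
  then have "0 < card (parcs G \<inter> V\<^sub>1 \<times> V\<^sub>2)"
    using fin by (simp add: card_gt_0_iff)
  then interpret star_comparison V\<^sub>1 V\<^sub>2 "parcs G" r \<alpha> "real i"
    using r card card2 i by unfold_locales (auto simp: sum_cdeg_card)
  have V_ne: "pverts G \<noteq> {}"
    using ne V by auto
  have super: "(\<Sum>u\<in>parcs G `` {v}. weight u) \<le> (r - 1) * weight v" if "v \<in> pverts G" for v
    using that slack1(1) slack2(1) V by auto
  note bound = graph_rho_le_supersolution[where y = weight, OF G V_ne weight_pos super]
  have "graph_rho G = r - 1"
    using bound(1) rho r(5) by linarith
  then have "(\<Sum>u\<in>parcs G `` {v}. weight u) = (r - 1) * weight v" if "v \<in> V\<^sub>1 \<union> V\<^sub>2" for v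
    using bound(2) conn that V by blast
  then obtain c W where "c \<in> V\<^sub>1" "W \<subseteq> V\<^sub>2" "real (card W) = real i"
    "parcs G = {(u, v). u \<in> V\<^sub>1 \<and> v \<in> V\<^sub>1 \<and> u \<noteq> v} \<union> {(u, v). u \<in> V\<^sub>2 \<and> v \<in> V\<^sub>2 \<and> u \<noteq> v}
      \<union> {c} \<times> W \<union> W \<times> {c}"
    using star_if_no_slack by blast
  then show ?thesis
    using two_cliques_with_star_iso_B_graph[OF G V card(1,2), of c W] by simp
qed

lemma two_large_parts_rho_le:
  assumes G: "pair_graph G" and conn: "Digraph_Component.connected (with_proj G)"
    and V: "pverts G = V\<^sub>1 \<union> V\<^sub>2" "V\<^sub>1 \<inter> V\<^sub>2 = {}" and ne: "V\<^sub>1 \<noteq> {}" "V\<^sub>2 \<noteq> {}"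
    and card: "card V\<^sub>1 \<le> c" "card V\<^sub>2 \<le> c" "2 * card (parcs G \<inter> V\<^sub>1 \<times> V\<^sub>2) \<le> c + 1"
  shows "graph_rho G \<le> real c"
proof -
  interpret bipartitioned_graph V\<^sub>1 V\<^sub>2 "parcs G"
    by (rule bipartitioned_graph_if_pair_graph[OF G V])
  interpret F: bipartitioned_graph V\<^sub>2 V\<^sub>1 "parcs G" by (rule flip)
  define E where "E = (\<Sum>u\<in>V\<^sub>1. cdeg u)"
  have "parcs G \<inter> V\<^sub>1 \<times> V\<^sub>2 \<noteq> {}"
    by (rule connected_cross_arc[OF G conn V ne])
  then have "0 < card (parcs G \<inter> V\<^sub>1 \<times> V\<^sub>2)"
    using fin by (simp add: card_gt_0_iff)
  then have E: "1 \<le> E" "2 * E \<le> real c + 1"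
    using card(3) by (simp_all add: E_def sum_cdeg_card)
  have E2: "E = (\<Sum>u\<in>V\<^sub>2. F.cdeg u)"
    unfolding E_def sum_cdeg_eq[symmetric] by (intro sum.cong) (simp_all add: cdeg_flip)
  let ?y = "\<lambda>w. 1 + cdeg w / E"
  have super: "(\<Sum>u\<in>parcs G `` {v}. ?y u) \<le> real c * ?y v" if v: "v \<in> pverts G" for v
  proof (cases "v \<in> V\<^sub>1")
    case True
    then show ?thesis
      using spread_supersolution[OF True E_def E(1)] card(1) E(2) by simp
  next
    case False
    then have v2: "v \<in> V\<^sub>2" using v V by blast
    have "(\<Sum>u\<in>parcs G `` {v}. 1 + F.cdeg u / E) \<le> real c * (1 + F.cdeg v / E)"
      using F.spread_supersolution[OF v2 E2 E(1)] card(2) E(2) by simp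
    moreover have "(\<Sum>u\<in>parcs G `` {v}. 1 + F.cdeg u / E) = (\<Sum>u\<in>parcs G `` {v}. ?y u)"
      using arcs by (intro sum.cong) (auto simp: cdeg_flip)
    ultimately show ?thesis
      using v2 by (simp add: cdeg_flip)
  qed
  have V_ne: "pverts G \<noteq> {}"
    using V ne by auto
  have pos: "0 < ?y v" for v
    using E(1) by (simp add: add_pos_nonneg)
  show ?thesis
    by (rule graph_rho_le_supersolution(1)[where y = ?y, OF G V_ne pos super])
qed

theorem theorem1p2:
  fixes k n \<delta> :: nat and G :: "'a pair_pre_digraph"
  assumes "k \<ge> 2"
    and "pair_graph G"
    and "Digraph_Component.connected (with_proj G)"
    and "min_degree G = \<delta>"
    and "\<delta> \<ge> 2 * k"
    and "card (pverts G) = n"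
    and "n \<ge> 2 * \<delta> + 3"
    and "graph_rho G \<ge> graph_rho (B_graph n (\<delta> + 1) (k - 1))"
  shows "spanning_tree_packing_number G \<ge> k \<or>
    digraph_iso (with_proj G) (with_proj (B_graph n (\<delta> + 1) (k - 1)))"
proof (rule disjCI)
  assume not_iso: "\<not> digraph_iso (with_proj G) (with_proj (B_graph n (\<delta> + 1) (k - 1)))"
  note G = assms(2) and conn = assms(3) and n = assms(6)
  interpret G: pair_graph G by (rule G)
  let ?V = "pverts G" and ?A = "parcs G"
  have ne: "?V \<noteq> {}"
    using n assms(7) by auto
  interpret M: min_degree_graph ?V ?A \<delta>
  proof
    show "finite ?V" by (rule G.pair_finite_verts)
    show "?A \<subseteq> ?V \<times> ?V"
      using G.in_arcsD1 G.in_arcsD2 by auto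
    show "(u, v) \<in> ?A \<Longrightarrow> (v, u) \<in> ?A" for u v
      using G.pair_sym_arcs by (auto simp: symmetric_def dest: symD)
    show "(u, u) \<notin> ?A" for u
      using G.pair_no_loops[of "(u, u)"] by auto
    show "\<delta> \<le> card (?A `` {v})" if "v \<in> ?V" for v
      using min_degree_le_neighbours[OF G that] assms(4) by simp
  qed
  have rho_gt: "real n - real \<delta> - 2 < graph_rho G"
  proof -
    have "real n - real (\<delta> + 1) - 1 < graph_rho (B_graph n (\<delta> + 1) (k - 1))"
      by (rule B_graph_rho_gt_clique) (use assms in auto)
    then show ?thesis using assms(8) by simp
  qed
  have edges: "\<exists>a\<in>?V. \<exists>b\<in>?V. e = {a, b}" if "e \<in> graph_edges G" for e
    using that M.arcs by (auto simp: graph_edges_def)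
  consider (forests) F where "forest_packing (graph_edges G) k F"
      "\<forall>i<k. \<forall>x\<in>?V. \<forall>y\<in>?V. (x, y) \<in> linked (F i)"
    | (sparse) P where "partition_on ?V P"
      "card {e \<in> graph_edges G. \<not> (\<exists>U\<in>P. e \<subseteq> U)} + k < k * card P"
    using spanning_forests_or_sparse_partition[OF G.pair_finite_verts ne, of "graph_edges G" k] edges
    by blast
  then show "k \<le> spanning_tree_packing_number G"
  proof cases
    case forests
    then show ?thesis
      using packing_number_ge_forest_packing[OF G, of k F] n assms(7) by auto
  next
    case sparse
    note P = sparse(1) and few = sparse(2)
    have sparse: "card (M.cross_arcs P) + 2 * k + 2 \<le> 2 * k * card P"
      using M.card_cross_arcs_le_edges[OF P] few unfolding graph_edges_def by linarith
    then have sparse': "card (M.cross_arcs P) + 2 * k < 2 * k * card P"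
      by simp
    obtain V\<^sub>1 V\<^sub>2 where parts: "V\<^sub>1 \<in> P" "V\<^sub>2 \<in> P" "V\<^sub>1 \<noteq> V\<^sub>2" "\<delta> < card V\<^sub>1" "\<delta> < card V\<^sub>2"
      using M.two_large_parts[OF P sparse' assms(5)] by blast
    have finP: "finite P"
      using P G.pair_finite_verts by (rule finite_elements[rotated])
    have False
    proof (cases "3 \<le> card P")
      case True
      \<comment> \<open>the constant for which the bound \<open>t + \<delta> - 1\<close> becomes \<open>n - \<delta> - 2\<close>\<close>
      define t where "t = real n - 2 * real \<delta> - 1"
      have t: "0 < t" "t + real \<delta> - 1 = real n - real \<delta> - 2"
        using assms(7) by (simp_all add: t_def)
      have m: "real (card ?A) \<le> (real (card ?V) - 1) * real \<delta> + t * (t + real \<delta> - 1)"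
        using M.card_arcs_le_three_parts[OF P sparse' assms(5) True]
        unfolding t(2) unfolding t_def n .
      have "graph_rho G \<le> t + real \<delta> - 1"
        by (rule graph_rho_le_supersolution(1)[OF G ne _ M.degree_supersolution[OF _ m]])
          (use t in \<open>simp_all add: add_nonneg_pos\<close>)
      then show False
        using rho_gt t(2) by simp
    next
      case False
      have "P = {V\<^sub>1, V\<^sub>2}"
        using card_seteq[of P "{V\<^sub>1, V\<^sub>2}"] parts finP False by auto
      then have V: "?V = V\<^sub>1 \<union> V\<^sub>2" "V\<^sub>1 \<inter> V\<^sub>2 = {}"
        using P parts(3) by (auto simp: partition_on_def disjoint_def)
      have V': "?V = V\<^sub>2 \<union> V\<^sub>1" "V\<^sub>2 \<inter> V\<^sub>1 = {}"
        using V by auto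
      interpret B: bipartitioned_graph V\<^sub>1 V\<^sub>2 ?A
        by (rule bipartitioned_graph_if_pair_graph[OF G V])
      have nonempty: "V\<^sub>1 \<noteq> {}" "V\<^sub>2 \<noteq> {}"
        using parts by auto
      have sum: "card V\<^sub>1 + card V\<^sub>2 = n"
        using n V B.fin by (simp add: card_Un_disjoint)
      have sym: "card (?A \<inter> V\<^sub>2 \<times> V\<^sub>1) = card (?A \<inter> V\<^sub>1 \<times> V\<^sub>2)"
      proof -
        have "?A \<inter> V\<^sub>2 \<times> V\<^sub>1 = (?A \<inter> V\<^sub>1 \<times> V\<^sub>2)\<inverse>"
          using B.sym by auto
        then show ?thesis by simp
      qed
      have "M.cross_arcs P = (?A \<inter> V\<^sub>1 \<times> V\<^sub>2) \<union> (?A \<inter> V\<^sub>2 \<times> V\<^sub>1)"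
        unfolding M.cross_arcs_def \<open>P = {V\<^sub>1, V\<^sub>2}\<close> using V B.arcs by auto
      then have "card (M.cross_arcs P) = 2 * card (?A \<inter> V\<^sub>1 \<times> V\<^sub>2)"
        using V B.fin sym by (simp add: card_Un_disjoint disjoint_iff)
      moreover have "card P = 2"
        using \<open>P = {V\<^sub>1, V\<^sub>2}\<close> parts(3) by simp
      ultimately have few': "card (?A \<inter> V\<^sub>1 \<times> V\<^sub>2) \<le> k - 1"
        using sparse by simp
      consider "card V\<^sub>1 = \<delta> + 1" | "card V\<^sub>2 = \<delta> + 1"
        | "\<delta> + 2 \<le> card V\<^sub>1" "\<delta> + 2 \<le> card V\<^sub>2"
        using parts by linarith
      then show False
      proof cases
        case 1
        show False
          using two_parts_extremal[OF G conn V 1 n _ _ _ _ few' assms(8)] not_iso assms by simp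
      next
        case 2
        show False
          using two_parts_extremal[OF G conn V' 2 n _ _ _ _ _ assms(8)] few' sym not_iso assms by simp
      next
        case 3
        have "graph_rho G \<le> real (n - \<delta> - 2)"
          by (rule two_large_parts_rho_le[OF G conn V nonempty]) (use 3 sum few' assms in linarith)+
        moreover have "real (n - \<delta> - 2) = real n - real \<delta> - 2"
          using assms(7) by linarith
        ultimately show False
          using rho_gt by simp
      qed
    qed
    then show ?thesis ..
  qed
qed

end
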